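(* Let $k\leq n-2$ and $m\geq1$, or let $k=n-1$ and $m\geq2$. If $G$ is an $m$-saturated crowded $(n-k)$-parade on $n$ vertices, then $G$ is minor maximal amongst graphs with $n$ vertices, at most $m$ parallel edges between any given pair of vertices, and spectator floor $k$.
   Context: All graphs are finite, have at least one vertex, have no loops, and may have multiple (parallel) edges. A minor of $H$ is any graph obtained from $H$ by a sequence of: deleting an isolated vertex, deleting an edge, contracting an edge that has no edge parallel to it. A graph $G$ in a class $\mathcal{C}$ is minor maximal in $\mathcal{C}$ if $G\in\mathcal{C}$ and no graph in $\mathcal{C}$ other than $G$ has $G$ as a minor. A unique shortest path is a shortest $u$–$v$ path $P$ such that every $u$–$v$ path with the same number of vertices is identical to $P$, where two paths with different edge sequences are different even if their vertex sequences agree; a single vertex is a unique shortest path. The parade number $\mathrm{usp}(G)$ is the largest number of vertices of a unique shortest path in $G$; a parade is a unique shortest path with $\mathrm{usp}(G)$ vertices. The spectator number is $\mathrm{sp}(G)=|V(G)|-\mathrm{usp}(G)$. The spectator floor $\lfloor \mathrm{sp}\rfloor(G)$ is the minimum of $\mathrm{sp}(H)$ over all graphs $H$ of which $G$ is a minor. For $p\geq2$, a crowded $p$-parade is a graph $G$ with a parade $P$ of $p$ vertices such that (i) every vertex outside $P$ is adjacent to exactly two vertices of $P$, and those two vertices are adjacent to each other; (ii) any two vertices outside $P$ that are adjacent to a common vertex of $P$ are adjacent to each other. An $m$-saturated crowded $p$-parade ($p\geq 2$) is a crowded $p$-parade in which every edge not in the parade has exactly $m$ parallel copies (including itself). An $m$-saturated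 crowded $1$-parade is a graph in which every pair of vertices is joined by exactly $m$ edges. *)

theory Defs
  imports Main
begin

type_synonym mgraph = "nat set \<times> (nat \<Rightarrow> nat \<Rightarrow> nat)"

definition verts :: "mgraph \<Rightarrow> nat set" where
  "verts G = fst G"

definition mult :: "mgraph \<Rightarrow> nat \<Rightarrow> nat \<Rightarrow> nat" where
  "mult G = snd G"

definition adj :: "mgraph \<Rightarrow> nat \<Rightarrow> nat \<Rightarrow> bool" where
  "adj G x y \<longleftrightarrow> mult G x y \<ge> 1"

definition wf_graph :: "mgraph \<Rightarrow> bool" where
  "wf_graph G \<longleftrightarrow> finite (verts G) \<and> verts G \<noteq> {}
     \<and> (\<forall>x y. mult G x y = mult G y x)
     \<and> (\<forall>x. mult G x x = 0)
     \<and> (\<forall>x y. mult G x y \<noteq> 0 \<longrightarrow> x \<in> verts G \<and> y \<in> verts G)"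

definition graph_iso :: "mgraph \<Rightarrow> mgraph \<Rightarrow> bool" where
  "graph_iso G H \<longleftrightarrow> (\<exists>f. bij_betw f (verts G) (verts H)
     \<and> (\<forall>x\<in>verts G. \<forall>y\<in>verts G. mult H (f x) (f y) = mult G x y))"

inductive minor_step :: "mgraph \<Rightarrow> mgraph \<Rightarrow> bool" where
  del_vertex: "\<lbrakk>v \<in> verts G; \<forall>w. mult G v w = 0; card (verts G) \<ge> 2\<rbrakk>
     \<Longrightarrow> minor_step G (verts G - {v}, mult G)"
| del_edge: "mult G u v \<ge> 1
     \<Longrightarrow> minor_step G (verts G,
           \<lambda>x y. if (x = u \<and> y = v) \<or> (x = v \<and> y = u) then mult G x y - 1 else mult G x y)"
| contract: "mult G u v = 1
     \<Longrightarrow> minor_step G (verts G - {v},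
           \<lambda>x y. if x = v \<or> y = v then 0
                 else if x = u \<and> y \<noteq> u then mult G u y + mult G v y
                 else if y = u \<and> x \<noteq> u then mult G x u + mult G x v
                 else mult G x y)"

definition is_minor :: "mgraph \<Rightarrow> mgraph \<Rightarrow> bool" where
  "is_minor G H \<longleftrightarrow> (\<exists>H'. minor_step\<^sup>*\<^sup>* H H' \<and> graph_iso H' G)"

definition is_path :: "mgraph \<Rightarrow> nat list \<Rightarrow> bool" where
  "is_path G P \<longleftrightarrow> P \<noteq> [] \<and> distinct P \<and> set P \<subseteq> verts G
     \<and> (\<forall>i. Suc i < length P \<longrightarrow> adj G (P ! i) (P ! Suc i))"

text \<open>Unique shortest path: shortest between its endpoints, every path with the same
endpoints and the same number of vertices has the same vertex sequence, and no edge on it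
has a parallel copy (otherwise a different edge sequence would exist).\<close>
definition is_usp :: "mgraph \<Rightarrow> nat list \<Rightarrow> bool" where
  "is_usp G P \<longleftrightarrow> is_path G P
     \<and> (\<forall>Q. is_path G Q \<and> hd Q = hd P \<and> last Q = last P \<longrightarrow> length P \<le> length Q)
     \<and> (\<forall>Q. is_path G Q \<and> hd Q = hd P \<and> last Q = last P \<and> length Q = length P \<longrightarrow> Q = P)
     \<and> (\<forall>i. Suc i < length P \<longrightarrow> mult G (P ! i) (P ! Suc i) = 1)"

definition usp :: "mgraph \<Rightarrow> nat" where
  "usp G = Max {length P | P. is_usp G P}"

definition is_parade :: "mgraph \<Rightarrow> nat list \<Rightarrow> bool" where
  "is_parade G P \<longleftrightarrow> is_usp G P \<and> length P = usp G"

definition sp :: "mgraph \<Rightarrow> nat" where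
  "sp G = card (verts G) - usp G"

definition sp_floor :: "mgraph \<Rightarrow> nat" where
  "sp_floor G = (LEAST s. \<exists>H. wf_graph H \<and> is_minor G H \<and> s = sp H)"

definition parade_edge :: "nat list \<Rightarrow> nat \<Rightarrow> nat \<Rightarrow> bool" where
  "parade_edge P x y \<longleftrightarrow> (\<exists>i. Suc i < length P \<and>
       ((x = P ! i \<and> y = P ! Suc i) \<or> (y = P ! i \<and> x = P ! Suc i)))"

definition crowded_wrt :: "mgraph \<Rightarrow> nat list \<Rightarrow> bool" where
  "crowded_wrt G P \<longleftrightarrow>
     (\<forall>x\<in>verts G - set P. card {y\<in>set P. adj G x y} = 2
        \<and> (\<forall>y\<in>set P. \<forall>z\<in>set P. adj G x y \<and> adj G x z \<and> y \<noteq> z \<longrightarrow> adj G y z))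
   \<and> (\<forall>x\<in>verts G - set P. \<forall>y\<in>verts G - set P.
        x \<noteq> y \<and> (\<exists>z\<in>set P. adj G x z \<and> adj G y z) \<longrightarrow> adj G x y)"

definition saturated_crowded_parade :: "nat \<Rightarrow> nat \<Rightarrow> mgraph \<Rightarrow> bool" where
  "saturated_crowded_parade m p G \<longleftrightarrow> wf_graph G \<and>
     (if p = 1 then (\<forall>x\<in>verts G. \<forall>y\<in>verts G. x \<noteq> y \<longrightarrow> mult G x y = m)
      else p \<ge> 2 \<and> (\<exists>P. is_parade G P \<and> length P = p \<and> crowded_wrt G P
             \<and> (\<forall>x y. adj G x y \<and> \<not> parade_edge P x y \<longrightarrow> mult G x y = m)))"

definition in_class :: "nat \<Rightarrow> nat \<Rightarrow> nat \<Rightarrow> mgraph \<Rightarrow> bool" where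
  "in_class n m k G \<longleftrightarrow> wf_graph G \<and> card (verts G) = n
     \<and> (\<forall>x y. mult G x y \<le> m) \<and> sp_floor G = k"

definition minor_maximal :: "(mgraph \<Rightarrow> bool) \<Rightarrow> mgraph \<Rightarrow> bool" where
  "minor_maximal C G \<longleftrightarrow> C G \<and> (\<forall>H. C H \<and> is_minor G H \<longrightarrow> graph_iso H G)"

end

theory Submission
  imports Defs
begin

text \<open>A unique shortest path $Q$ of $H$, with vertices levelled by their distance from one end of
$Q$, has two features: adjacent vertices have levels differing by at most one, and a vertex outside $Q$ is
never adjacent to a vertex of $Q$ of higher level (otherwise $Q$ would not be the only shortest
path). Such a structure can be carried through edge deletions, vertex deletions and contractions
without increasing the number of vertices outside $Q$. Hence if $G$ is a minor of $H$, then $G$ itself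
carries such a structure with at most $\mathrm{sp}(H)$ spectators. A crowded $p$-parade has diameter
at most $p - 1$, so no such structure on it has more than $p$ path vertices, which gives the lower bound on
the spectator floor. A proper supergraph of $G$ with the same floor would carry such a structure with $p$
path vertices; this structure is then essentially the parade itself, and all edges it permits are
already present in $G$ with full multiplicity.\<close>

section \<open>Layouts and minors\<close>

text \<open>A relaxation of ``$Q$ is a unique shortest path'' that survives taking minors: \<open>l\<close> plays the
role of the distance from one end of the path, and the consecutive vertices of $Q$ need not be
adjacent, nor need their levels be consecutive.\<close>
definition layout :: "mgraph \<Rightarrow> nat set \<Rightarrow> (nat \<Rightarrow> nat) \<Rightarrow> bool" where
  "layout G Q l \<longleftrightarrow> Q \<subseteq> verts G \<and> inj_on l Q
     \<and> (\<forall>x y. adj G x y \<longrightarrow> l x \<le> l y + 1)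
     \<and> (\<forall>x y. adj G x y \<longrightarrow> x \<notin> Q \<longrightarrow> y \<in> Q \<longrightarrow> l y \<le> l x)
     \<and> (\<forall>x\<in>Q. \<forall>y\<in>Q. mult G x y \<le> 1)"

lemma adj_sym: "wf_graph G \<Longrightarrow> adj G x y \<Longrightarrow> adj G y x"
  by (metis adj_def wf_graph_def)

lemma adj_verts: "wf_graph G \<Longrightarrow> adj G x y \<Longrightarrow> x \<in> verts G \<and> y \<in> verts G \<and> x \<noteq> y"
  unfolding wf_graph_def adj_def by (metis not_one_le_zero)

lemma not_adj_iff: "\<not> adj G x y \<longleftrightarrow> mult G x y = 0"
  by (simp add: adj_def not_le)

lemma verts_simp [simp]: "verts (V, f) = V" and mult_simp [simp]: "mult (V, f) = f"
  by (simp_all add: verts_def mult_def)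

lemma layout_mono:
  assumes lay: "layout G Q l" and V: "verts H = verts G" and le: "\<And>x y. mult H x y \<le> mult G x y"
  shows "layout H Q l"
proof -
  have "adj H x y \<Longrightarrow> adj G x y" for x y using le[of x y] unfolding adj_def by linarith
  moreover have "mult G x y \<le> 1 \<Longrightarrow> mult H x y \<le> 1" for x y using le[of x y] by linarith
  ultimately show ?thesis using lay V unfolding layout_def by simp
qed

lemma minor_step_wf:
  assumes "minor_step G H" "wf_graph G"
  shows "wf_graph H"
proof -
  have sym: "mult G x y = mult G y x" and irr: "mult G x x = 0"
    and supp: "0 < mult G x y \<Longrightarrow> x \<in> verts G \<and> y \<in> verts G"
    and fin: "finite (verts G)" "verts G \<noteq> {}" for x y
    using assms(2) unfolding wf_graph_def by auto
  show ?thesis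
    using assms(1)
  proof cases
    case (del_vertex v)
    then have "verts G - {v} \<noteq> {}" by (metis Diff_eq_empty_iff card_mono card.empty card_insert_if
          empty_iff finite.emptyI finite_insert not_less_eq_eq numeral_2_eq_2)
    then show ?thesis using del_vertex sym irr supp fin unfolding wf_graph_def
      by simp (metis less_irrefl)
  next
    case (del_edge u v)
    have "mult H x y = mult H y x" "mult H x x = 0" for x y
      unfolding del_edge(1) using sym irr by auto
    moreover have "0 < mult H x y \<Longrightarrow> 0 < mult G x y" for x y
      unfolding del_edge(1) by (simp split: if_splits)
    moreover have "verts H = verts G" using del_edge by simp
    ultimately show ?thesis using supp fin unfolding wf_graph_def by (simp, blast)
  next
    case (contract u v)
    have "u \<in> verts G" "u \<noteq> v" using supp[of u v] irr[of u] contract by auto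
    then have "mult H x y = 0" if "x \<notin> verts H \<or> y \<notin> verts H" for x y
      using that supp[of x y] supp[of u y] supp[of v y] supp[of x u] supp[of x v]
      unfolding contract(1) by auto
    moreover have "mult H x y = mult H y x" "mult H x x = 0" for x y
      unfolding contract(1) using sym irr by auto
    moreover have "finite (verts H)" "verts H \<noteq> {}"
      using fin \<open>u \<in> verts G\<close> \<open>u \<noteq> v\<close> unfolding contract(1) by auto
    ultimately show ?thesis unfolding wf_graph_def by metis
  qed
qed

lemma minor_steps_wf: "minor_step\<^sup>*\<^sup>* G H \<Longrightarrow> wf_graph G \<Longrightarrow> wf_graph H"
  by (induction rule: rtranclp_induct) (auto intro: minor_step_wf)

text \<open>With \<open>i\<close> the lower level of the contracted edge, the levels \<open>i\<close> and \<open>i + 1\<close> are merged and the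
vertex of \<open>Q\<close> at level \<open>i\<close>, if any, becomes a spectator. So \<open>Q\<close> loses at most one vertex, just as the
graph does, and the number of spectators does not grow.\<close>
lemma layout_contract:
  fixes u v :: nat and G :: mgraph
  defines "G' \<equiv> (verts G - {v},
           \<lambda>x y. if x = v \<or> y = v then 0
                 else if x = u \<and> y \<noteq> u then mult G u y + mult G v y
                 else if y = u \<and> x \<noteq> u then mult G x u + mult G x v
                 else mult G x y)"
  assumes wf: "wf_graph G" and uv: "mult G u v = 1" and lay: "layout G Q l"
  shows "\<exists>Q' l'. layout G' Q' l' \<and> card Q \<le> card Q' + 1"
proof -
  have sym: "mult G x y = mult G y x" and irr: "mult G x x = 0"
    and supp: "mult G x y \<noteq> 0 \<Longrightarrow> x \<in> verts G \<and> y \<in> verts G" for x y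
    using wf unfolding wf_graph_def by blast+
  have finQ: "finite Q" using wf lay unfolding wf_graph_def layout_def
    by (meson finite_subset)
  have QV: "Q \<subseteq> verts G" and inj: "inj_on l Q" and lip: "\<And>x y. adj G x y \<Longrightarrow> l x \<le> l y + 1"
    and spec: "\<And>x y. adj G x y \<Longrightarrow> x \<notin> Q \<Longrightarrow> y \<in> Q \<Longrightarrow> l y \<le> l x"
    and one: "\<And>x y. x \<in> Q \<Longrightarrow> y \<in> Q \<Longrightarrow> mult G x y \<le> 1"
    using lay unfolding layout_def by auto
  have auv: "adj G u v" "adj G v u" using uv sym[of u v] by (auto simp: adj_def)
  have uV: "u \<in> verts G" and vu: "u \<noteq> v" using adj_verts[OF wf auv(1)] by auto
  define i where "i = min (l u) (l v)"
  have li: "l u = i \<or> l u = i + 1" "l v = i \<or> l v = i + 1" "l u = i \<or> l v = i"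
    using lip[OF auv(1)] lip[OF auv(2)] unfolding i_def by auto
  \<comment> \<open>\<open>\<phi>\<close> is the quotient map of the contraction, and
    \<open>c\<close> merges the levels \<open>i\<close> and \<open>i + 1\<close>. Both
    \<open>u\<close> and \<open>v\<close> lie on these two levels, so \<open>l'\<close> is
    \<open>c\<close> applied to the old level.\<close>
  define \<phi> where "\<phi> z = (if z = v then u else z)" for z
  define c where "c t = (if t \<le> i then t else t - 1)" for t
  define l' where "l' z = (if z = u then i else c (l z))" for z
  define Q' where "Q' = \<phi> ` {z \<in> Q. l z \<noteq> i}"
  have c_mono: "s \<le> t \<Longrightarrow> c s \<le> c t" for s t by (auto simp: c_def)
  have c_lip: "s \<le> t + 1 \<Longrightarrow> c s \<le> c t + 1" for s t by (auto simp: c_def)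
  have c_inj: "s \<noteq> i \<Longrightarrow> t \<noteq> i \<Longrightarrow> c s = c t \<Longrightarrow> s = t" for s t
    by (auto simp: c_def split: if_splits)
  have l'\<phi>: "l' (\<phi> z) = c (l z)" for z
    using li by (auto simp: l'_def \<phi>_def c_def)
  have lift: "\<exists>x0 y0. adj G x0 y0 \<and> x = \<phi> x0 \<and> y = \<phi> y0" if "adj G' x y" for x y
  proof -
    have nv: "x \<noteq> v" "y \<noteq> v" using that by (auto simp: adj_def G'_def)
    consider "x = u" "y \<noteq> u" | "y = u" "x \<noteq> u" | "x = u \<longleftrightarrow> y = u" by blast
    then show ?thesis
    proof cases
      case 1
      then have "adj G u y \<or> adj G v y" using that nv by (auto simp: adj_def G'_def)
      moreover have "\<phi> u = u" "\<phi> v = u" "\<phi> y = y" using nv by (auto simp: \<phi>_def)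
      ultimately show ?thesis using 1 by metis
    next
      case 2
      then have "adj G x u \<or> adj G x v" using that nv by (auto simp: adj_def G'_def)
      moreover have "\<phi> u = u" "\<phi> v = u" "\<phi> x = x" using nv by (auto simp: \<phi>_def)
      ultimately show ?thesis using 2 by metis
    next
      case 3
      then have "adj G x y" using that nv by (auto simp: adj_def G'_def split: if_splits)
      moreover have "\<phi> x = x" "\<phi> y = y" using nv by (auto simp: \<phi>_def)
      ultimately show ?thesis by metis
    qed
  qed
  \<comment> \<open>If \<open>z0\<close> is in \<open>Q\<close> on the upper level
    \<open>i + 1\<close>, the other end has level \<open>i\<close>; as a spectator it would be
    adjacent to a path vertex of higher level.\<close>
  have both: "z \<in> Q" if "{z, z0} = {u, v}" "z0 \<in> Q" "l z0 \<noteq> i" for z z0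
  proof (rule ccontr)
    assume "z \<notin> Q"
    have "l z < l z0" using that li by (auto simp: doubleton_eq_iff)
    moreover have "adj G z z0" using that auv by (auto simp: doubleton_eq_iff)
    ultimately show False using spec[of z z0] that \<open>z \<notin> Q\<close> by auto
  qed
  have \<phi>_eq: "\<phi> a = \<phi> b \<longleftrightarrow> a = b \<or> {a, b} = {u, v}" for a b
    using vu by (auto simp: \<phi>_def doubleton_eq_iff)
  have "layout G' Q' l'" unfolding layout_def
  proof (intro conjI allI impI ballI)
    show "Q' \<subseteq> verts G'" using QV uV vu by (auto simp: Q'_def G'_def \<phi>_def)
    show "inj_on l' Q'"
      unfolding Q'_def using inj c_inj by (auto simp: inj_on_def l'\<phi>)
  next
    fix x y assume "adj G' x y"
    then show "l' x \<le> l' y + 1" using lift lip c_lip l'\<phi> by metis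
  next
    fix x y assume a: "adj G' x y" "x \<notin> Q'" "y \<in> Q'"
    obtain x0 y0 where xy: "adj G x0 y0" "x = \<phi> x0" "y = \<phi> y0" using lift a by blast
    obtain y1 where y1: "y1 \<in> Q" "l y1 \<noteq> i" "y = \<phi> y1" using a by (auto simp: Q'_def)
    have "y0 \<in> Q" using both[of y0 y1] y1 xy \<phi>_eq by metis
    \<comment> \<open>If \<open>x0\<close> is in \<open>Q\<close>, it left the path only because its
      level is \<open>i\<close>; then \<open>y0\<close> has level at most \<open>i + 1\<close>,
      which collapses to \<open>i\<close>.\<close>
    have "c (l y0) \<le> c (l x0)"
    proof (cases "x0 \<in> Q")
      case True
      then have "l x0 = i" using a xy by (auto simp: Q'_def)
      then show ?thesis using lip[OF adj_sym[OF wf xy(1)]] by (auto simp: c_def)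
    next
      case False
      then show ?thesis using spec[OF xy(1)] \<open>y0 \<in> Q\<close> c_mono by auto
    qed
    then show "l' y \<le> l' x" using xy l'\<phi> by simp
  next
    have G'sym: "mult G' x y = mult G' y x" for x y
      using sym[of x y] sym[of x u] sym[of x v] sym[of y u] sym[of y v] by (simp add: G'_def)
    \<comment> \<open>For \<open>y\<close> other than \<open>u\<close>, edges from two old vertices
      on levels \<open>i\<close> and \<open>i + 1\<close> add up. By injectivity \<open>y\<close> is
      on neither level, so it is too far from one of them and only one summand can be
      nonzero.\<close>
    have at_u: "mult G' u y \<le> 1" if "u \<in> Q'" "y \<in> Q'" for y
    proof -
      obtain x0 y0 where x0: "x0 \<in> Q" "l x0 \<noteq> i" "u = \<phi> x0" and y0: "y0 \<in> Q" "l y0 \<noteq> i" "y = \<phi> y0"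
        using \<open>u \<in> Q'\<close> \<open>y \<in> Q'\<close> unfolding Q'_def by auto
      show ?thesis
      proof (cases "y = u")
        case True
        then show ?thesis using irr vu by (simp add: G'_def)
      next
        case False
        then have y: "y = y0" "y \<noteq> v" using y0 vu by (auto simp: \<phi>_def split: if_splits)
        have "x0 = u \<or> x0 = v" using x0 by (auto simp: \<phi>_def split: if_splits)
        then obtain z where z: "{z, x0} = {u, v}" by blast
        have zQ: "z \<in> Q" "l z = i" "l x0 = i + 1"
          using both[OF z x0(1,2)] z li x0 by (auto simp: doubleton_eq_iff)
        have "l y \<noteq> i + 1" using inj x0 y0 y zQ False \<open>x0 = u \<or> x0 = v\<close>
          by (metis inj_on_def)
        then have "l y + 1 < l x0 \<or> l z + 1 < l y" using y y0 zQ by auto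
        then have "mult G x0 y = 0 \<or> mult G z y = 0"
          using lip[of x0 y] lip[of y z] sym[of y z] by (metis add_lessD1 leD not_adj_iff not_less)
        then have "mult G x0 y + mult G z y \<le> 1" using one[of x0 y] one[of z y] x0 zQ y y0 by auto
        moreover have "mult G' u y = mult G x0 y + mult G z y"
          using z y vu False by (auto simp: G'_def doubleton_eq_iff)
        ultimately show ?thesis by simp
      qed
    qed
    fix x y assume xy: "x \<in> Q'" "y \<in> Q'"
    show "mult G' x y \<le> 1"
    proof (cases "x = u \<or> y = u")
      case True
      then show ?thesis using at_u xy G'sym by metis
    next
      case False
      then have "x \<in> Q" "y \<in> Q" using xy by (auto simp: Q'_def \<phi>_def split: if_splits)
      then show ?thesis using False one by (simp add: G'_def)
    qed
  qed
  moreover have "card Q \<le> card Q' + 1"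
  proof -
    have "inj_on \<phi> {z \<in> Q. l z \<noteq> i}"
      unfolding inj_on_def \<phi>_eq using li(3) by (auto simp: doubleton_eq_iff)
    then have "card Q' = card {z \<in> Q. l z \<noteq> i}" by (simp add: Q'_def card_image)
    moreover have "card {z \<in> Q. l z = i} \<le> 1"
      using inj finQ by (auto simp: card_le_Suc0_iff_eq inj_on_def)
    moreover have "Q = {z \<in> Q. l z \<noteq> i} \<union> {z \<in> Q. l z = i}" by auto
    then have "card Q \<le> card {z \<in> Q. l z \<noteq> i} + card {z \<in> Q. l z = i}"
      using card_Un_le by metis
    ultimately show ?thesis by linarith
  qed
  ultimately show ?thesis by blast
qed

text \<open>The inequality says that the number of vertices outside the layout does not grow, with
  sums in place of truncated differences. Edge deletions keep the layout; a vertex deletion takes at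
  most that vertex out of \<open>Q\<close>.\<close>

lemma layout_minor_step:
  assumes step: "minor_step G H" and wf: "wf_graph G" and lay: "layout G Q l"
  shows "\<exists>Q' l'. layout H Q' l' \<and> card (verts H) + card Q \<le> card (verts G) + card Q'"
  using step
proof cases
  case (del_vertex v)
  have fin: "finite Q" "finite (verts G)"
    using wf lay unfolding wf_graph_def layout_def by (auto intro: finite_subset)
  have "layout H (Q - {v}) l"
    using lay del_vertex wf unfolding layout_def adj_def wf_graph_def
    by (auto intro: inj_on_subset)
  moreover have "card (verts H) + 1 = card (verts G)"
    using del_vertex fin by (simp add: card_Suc_Diff1)
  moreover have "card Q \<le> card (Q - {v}) + 1" 
    by (cases "v \<in> Q") (use card_Suc_Diff1[OF fin(1), of v] in linarith, simp)
  ultimately have "card (verts H) + card Q \<le> card (verts G) + card (Q - {v})" by linarith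
  with \<open>layout H (Q - {v}) l\<close> show ?thesis by blast
next
  case (del_edge u v)
  have "mult H x y \<le> mult G x y" for x y using del_edge by auto
  then have "layout H Q l" using layout_mono[OF lay, of H] del_edge by simp
  then show ?thesis using del_edge by auto
next
  case (contract u v)
  have "v \<in> verts G" "finite (verts G)"
    using contract wf adj_verts[OF wf, of u v] by (auto simp: adj_def wf_graph_def)
  moreover have "verts H = verts G - {v}" using contract(1) by simp
  ultimately have "card (verts H) + 1 = card (verts G)"
    by (metis Suc_eq_plus1 card_Suc_Diff1)
  moreover obtain Q' l' where "layout H Q' l'" "card Q \<le> card Q' + 1"
    using layout_contract[OF wf contract(2) lay] contract(1) by blast
  ultimately have "card (verts H) + card Q \<le> card (verts G) + card Q'" by linarith
  with \<open>layout H Q' l'\<close> show ?thesis by blast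
qed

lemma layout_minor_steps:
  assumes "minor_step\<^sup>*\<^sup>* G H" "wf_graph G" "layout G Q l"
  shows "\<exists>Q' l'. layout H Q' l' \<and> card (verts H) + card Q \<le> card (verts G) + card Q'"
  using assms(1)
proof (induction rule: rtranclp_induct)
  case base
  then show ?case using assms(3) by blast
next
  case (step H1 H2)
  then obtain Q' l' where 1: "layout H1 Q' l'" "card (verts H1) + card Q \<le> card (verts G) + card Q'"
    by blast
  obtain Q'' l'' where 2: "layout H2 Q'' l''" "card (verts H2) + card Q' \<le> card (verts H1) + card Q''"
    using layout_minor_step[OF step(2) minor_steps_wf[OF step(1) assms(2)] 1(1)] by blast
  have "card (verts H2) + card Q \<le> card (verts G) + card Q''" using 1(2) 2(2) by linarith
  then show ?case using 2(1) by blast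
qed

lemma layout_iso:
  assumes iso: "graph_iso G H" and wf: "wf_graph H" and lay: "layout G Q l"
  shows "\<exists>Q' l'. layout H Q' l' \<and> card Q' = card Q"
proof -
  obtain f where f: "bij_betw f (verts G) (verts H)"
    and m: "\<And>x y. x \<in> verts G \<Longrightarrow> y \<in> verts G \<Longrightarrow> mult H (f x) (f y) = mult G x y"
    using iso unfolding graph_iso_def by blast
  define g where "g = inv_into (verts G) f"
  have g: "g y \<in> verts G \<and> f (g y) = y" if "y \<in> verts H" for y
    using that f unfolding g_def by (metis bij_betw_imp_surj_on f_inv_into_f inv_into_into)
  have gf: "g (f x) = x" if "x \<in> verts G" for x
    using that f unfolding g_def by (metis bij_betw_inv_into_left)
  have QV: "Q \<subseteq> verts G" using lay by (simp add: layout_def)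
  have m': "mult H x y = mult G (g x) (g y)" if "x \<in> verts H" "y \<in> verts H" for x y
    using m g that by metis
  have a: "adj G (g x) (g y) \<and> x \<in> verts H \<and> y \<in> verts H" if "adj H x y" for x y
    using adj_verts[OF wf that] m' that by (simp add: adj_def)
  have mem: "x \<in> f ` Q \<longleftrightarrow> g x \<in> Q" if "x \<in> verts H" for x
  proof
    assume "x \<in> f ` Q" then show "g x \<in> Q" using gf QV by auto
  next
    assume "g x \<in> Q" then show "x \<in> f ` Q" using g[OF that] by (metis imageI)
  qed
  have "layout H (f ` Q) (l \<circ> g)" unfolding layout_def
  proof (intro conjI allI impI ballI)
    show "f ` Q \<subseteq> verts H" using QV f by (auto simp: bij_betw_def)
    have "inj_on l Q" using lay by (simp add: layout_def)
    then show "inj_on (l \<circ> g) (f ` Q)" using QV gf by (auto simp: inj_on_def subset_iff)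
    show "(l \<circ> g) x \<le> (l \<circ> g) y + 1" if "adj H x y" for x y
      using a[OF that] lay by (simp add: layout_def)
    show "(l \<circ> g) y \<le> (l \<circ> g) x" if "adj H x y" "x \<notin> f ` Q" "y \<in> f ` Q" for x y
      using a[OF that(1)] that mem lay by (simp add: layout_def)
    show "mult H x y \<le> 1" if xy: "x \<in> f ` Q" "y \<in> f ` Q" for x y
    proof -
      have "x \<in> verts H" "y \<in> verts H" using xy \<open>f ` Q \<subseteq> verts H\<close> by auto
      then show ?thesis using xy mem m' lay by (simp add: layout_def)
    qed
  qed
  moreover have "card (f ` Q) = card Q"
    using f QV by (meson bij_betw_def card_image inj_on_subset)
  ultimately show ?thesis by blast
qed

lemma layout_minor:
  assumes "is_minor G H" "wf_graph G" "wf_graph H" "layout H Q l"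
  shows "\<exists>Q' l'. layout G Q' l' \<and> card (verts G) + card Q \<le> card (verts H) + card Q'"
proof -
  obtain H' where H': "minor_step\<^sup>*\<^sup>* H H'" "graph_iso H' G"
    using assms(1) unfolding is_minor_def by blast
  obtain Q1 l1 where 1: "layout H' Q1 l1" "card (verts H') + card Q \<le> card (verts H) + card Q1"
    using layout_minor_steps[OF H'(1) assms(3,4)] by blast
  obtain Q2 l2 where 2: "layout G Q2 l2" "card Q2 = card Q1"
    using layout_iso[OF H'(2) assms(2) 1(1)] by blast
  have "card (verts H') = card (verts G)"
    using H'(2) unfolding graph_iso_def by (blast dest: bij_betw_same_card)
  then have "card (verts G) + card Q \<le> card (verts H) + card Q2" using 1(2) 2(2) by simp
  then show ?thesis using 2(1) by blast
qed

section \<open>Unique shortest paths\<close>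

text \<open>Vertices may repeat, so walks concatenate freely. As for paths, length is counted in
  vertices.\<close>

definition walk :: "mgraph \<Rightarrow> nat \<Rightarrow> nat \<Rightarrow> nat list \<Rightarrow> bool" where
  "walk G x y P \<longleftrightarrow> P \<noteq> [] \<and> hd P = x \<and> last P = y \<and> successively (adj G) P"

lemma is_path_iff:
  "is_path G P \<longleftrightarrow> walk G (hd P) (last P) P \<and> distinct P \<and> set P \<subseteq> verts G"
  unfolding is_path_def walk_def successively_conv_nth by auto

lemma walk_append: "walk G x y P \<Longrightarrow> walk G z w R \<Longrightarrow> adj G y z \<Longrightarrow> walk G x w (P @ R)"
  by (simp add: walk_def successively_append_iff)

lemma walk_single: "walk G x x [x]"
  by (simp add: walk_def)

lemma walk_verts:
  assumes "wf_graph G" "walk G x y P" "x \<in> verts G"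
  shows "set P \<subseteq> verts G"
proof -
  have "successively (adj G) P \<Longrightarrow> P \<noteq> [] \<Longrightarrow> hd P \<in> verts G \<Longrightarrow> set P \<subseteq> verts G"
    by (induction P rule: induct_list012) (auto dest: adj_verts[OF assms(1)])
  then show ?thesis using assms by (auto simp: walk_def)
qed

text \<open>Cutting out the part between two occurrences of a vertex shortens a walk strictly. Hence
  a resulting path of the same length is the walk itself, which keeps uniqueness arguments
  available.\<close>

lemma walk_to_path:
  assumes "wf_graph G" "walk G x y P" "x \<in> verts G"
  shows "\<exists>R. is_path G R \<and> hd R = x \<and> last R = y \<and> length R \<le> length P
     \<and> (length R = length P \<longrightarrow> R = P)"
  using assms(2)
proof (induction "length P" arbitrary: P rule: less_induct)
  case less
  show ?case
  proof (cases "distinct P")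
    case True
    then have "is_path G P" using less.prems walk_verts[OF assms(1) less.prems assms(3)]
      by (auto simp: is_path_iff walk_def)
    then show ?thesis using less.prems by (auto simp: walk_def)
  next
    case False
    then obtain xs ys zs a where P: "P = xs @ [a] @ ys @ [a] @ zs" by (meson not_distinct_decomp)
    let ?P = "xs @ [a] @ zs"
    have "walk G x y ?P"
      using less.prems unfolding walk_def P successively_append_iff
      by (auto simp: successively_append_iff hd_append split: if_splits)
    moreover have shorter: "length ?P < length P" by (simp add: P)
    ultimately obtain R where "is_path G R" "hd R = x" "last R = y" "length R \<le> length ?P"
      using less.hyps by blast
    moreover from this have "length R < length P" using shorter by linarith
    ultimately show ?thesis by auto
  qed
qed

text \<open>Detours spliced into \<open>Q\<close> need not be paths, so minimality and uniqueness
  are extended to walks.\<close>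

lemma usp_walk:
  assumes wf: "wf_graph G" and Q: "is_usp G Q" and W: "walk G (hd Q) (last Q) W"
  shows "length Q \<le> length W" "length W = length Q \<Longrightarrow> W = Q"
proof -
  have "hd Q \<in> verts G" using Q by (auto simp: is_usp_def is_path_def)
  then obtain R where R: "is_path G R" "hd R = hd Q" "last R = last Q" "length R \<le> length W"
    "length R = length W \<longrightarrow> R = W"
    using walk_to_path[OF wf W] by blast
  have *: "length Q \<le> length R" using Q R unfolding is_usp_def by blast
  then show "length Q \<le> length W" using R by linarith
  show "W = Q" if "length W = length Q"
    using * that R Q unfolding is_usp_def by (metis le_antisym)
qed

text \<open>The level of a vertex is its distance from the first vertex of the path. A spectator
adjacent to a path vertex of higher level would lie on a second shortest path.\<close>
lemma usp_layout:
  assumes wf: "wf_graph G" and Q: "is_usp G Q"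
  shows "\<exists>l. layout G (set Q) l \<and> (\<forall>i<length Q. l (Q ! i) = Suc i)"
proof -
  define a where "a = hd Q"
  \<comment> \<open>Lengths count vertices, so the first path vertex has level 1.\<close>
  define d where "d x = (LEAST n. \<exists>P. walk G a x P \<and> length P = n)" for x
  have path: "is_path G Q" and Qne: "Q \<noteq> []" using Q by (auto simp: is_usp_def is_path_def)
  have d_le: "d x \<le> length P" if "walk G a x P" for x P
    unfolding d_def using that by (intro Least_le) blast
  have d_walk: "\<exists>P. walk G a x P \<and> length P = d x" if "walk G a x P" for x P
    unfolding d_def by (rule LeastI_ex) (use that in blast)
  have extend: "walk G a y (P @ [y])" if "walk G a x P" "adj G x y" for x y P
    using walk_append[OF that(1) walk_single that(2)] .
  have lip: "d x \<le> d y + 1" if xy: "adj G x y" for x y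
  proof (cases "\<exists>P. walk G a y P")
    case True
    then obtain P where "walk G a y P" "length P = d y" using d_walk by blast
    then show ?thesis using d_le[OF extend] adj_sym[OF wf xy] by fastforce
  next
    case False
    \<comment> \<open>Neither vertex is reachable, so both levels are \<open>LEAST\<close> of the
      same empty predicate and hence equal.\<close>
    then have "\<nexists>P. walk G a x P" using extend xy by blast
    then show ?thesis using False unfolding d_def by simp
  qed
  have finish: "walk G a (last Q) (P @ drop (Suc i) Q)"
    if "walk G a (Q ! i) P" "i < length Q" for i P
  proof (cases "Suc i < length Q")
    case True
    have "successively (adj G) (take (Suc i) Q @ drop (Suc i) Q)"
      using path by (simp add: is_path_iff walk_def)
    then have "successively (adj G) (drop (Suc i) Q)" unfolding successively_append_iff by blast
    then have "walk G (Q ! Suc i) (last Q) (drop (Suc i) Q)"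
      using True by (simp add: walk_def hd_drop_conv_nth last_drop)
    moreover have "adj G (Q ! i) (Q ! Suc i)" using path True by (simp add: is_path_def)
    ultimately show ?thesis using walk_append that by blast
  next
    case False
    then have "i = length Q - 1" using that by simp
    then have "Q ! i = last Q" using Qne by (simp add: last_conv_nth)
    then show ?thesis using that False by simp
  qed
  have d_ge: "Suc i \<le> length P" if "walk G a (Q ! i) P" "i < length Q" for i P
    using usp_walk(1)[OF wf Q] finish[OF that] that(2) unfolding a_def by fastforce
  have start: "walk G a (Q ! i) (take (Suc i) Q)" if "i < length Q" for i
  proof -
    have "successively (adj G) (take (Suc i) Q @ drop (Suc i) Q)"
      using path by (simp add: is_path_iff walk_def)
    then have "successively (adj G) (take (Suc i) Q)" unfolding successively_append_iff by blast
    then show ?thesis using that Qne by (simp add: walk_def a_def take_Suc_conv_app_nth hd_append hd_conv_nth)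
  qed
  have dQ: "d (Q ! i) = Suc i" if i: "i < length Q" for i
  proof -
    obtain P where "walk G a (Q ! i) P" "length P = d (Q ! i)" using d_walk[OF start[OF i]] by blast
    then have "Suc i \<le> d (Q ! i)" using d_ge[of i P] i by simp
    moreover have "d (Q ! i) \<le> Suc i" using d_le[OF start[OF i]] i by simp
    ultimately show ?thesis by simp
  qed
  have spec: "d y \<le> d x" if xy: "adj G x y" "x \<notin> set Q" "y \<in> set Q" for x y
  proof (rule ccontr)
    assume *: "\<not> d y \<le> d x"
    obtain j where j: "j < length Q" "y = Q ! j" using xy by (metis in_set_conv_nth)
    obtain P where P: "walk G a x P" "length P = d x"
      using d_walk extend[OF start[OF j(1)], of x] adj_sym[OF wf xy(1)] j by blast
    \<comment> \<open>By \<open>*\<close> this walk through the spectator \<open>x\<close> has at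
      most as many vertices as \<open>Q\<close>, so it equals \<open>Q\<close> and \<open>x\<close>
      would lie on \<open>Q\<close>.\<close>
    have W: "walk G a (last Q) ((P @ [y]) @ drop (Suc j) Q)"
      using finish[of j "P @ [y]"] extend[OF P(1) xy(1)] j by simp
    have "length ((P @ [y]) @ drop (Suc j) Q) \<le> length Q" using j * dQ P by simp
    then have "(P @ [y]) @ drop (Suc j) Q = Q"
      using usp_walk[OF wf Q W[unfolded a_def]] by (meson le_antisym)
    then have "set P \<subseteq> set Q" by (metis append_assoc Un_upper1 set_append)
    moreover have "x \<in> set P" using P by (auto simp: walk_def)
    ultimately show False using xy by blast
  qed
  \<comment> \<open>Levels increase by one along \<open>Q\<close>, so adjacent path vertices are
    consecutive on \<open>Q\<close>, where edges are single.\<close>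
  have mult1: "mult G (Q ! i) (Q ! j) \<le> 1" if ij: "i < length Q" "j < length Q" for i j
  proof (cases "adj G (Q ! i) (Q ! j)")
    case True
    have "i \<noteq> j" using adj_verts[OF wf True] by auto
    then have "j = Suc i \<or> i = Suc j"
      using lip[OF True] lip[OF adj_sym[OF wf True]] dQ ij by auto
    then show ?thesis using Q wf ij unfolding is_usp_def wf_graph_def by (metis order_refl)
  next
    case False
    then show ?thesis by (simp add: adj_def)
  qed
  have "inj_on d (set Q)" using dQ by (auto simp: inj_on_def in_set_conv_nth)
  then have "layout G (set Q) d" unfolding layout_def
    using lip spec mult1 path by (auto simp: is_path_def in_set_conv_nth)
  then show ?thesis using dQ by blast
qed

text \<open>The set under \<open>Max\<close> is nonempty because single vertices are unique shortest
  paths, and finite because a path has at most \<open>card (verts G)\<close> vertices.\<close>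

lemma usp_attained:
  assumes wf: "wf_graph G"
  shows "\<exists>Q. is_usp G Q \<and> length Q = usp G"
proof -
  let ?S = "{length P | P. is_usp G P}"
  obtain v where v: "v \<in> verts G" using wf unfolding wf_graph_def by blast
  have "is_usp G [v]"
    unfolding is_usp_def
  proof (intro conjI allI impI)
    show "is_path G [v]" using v by (simp add: is_path_def)
  next
    fix Q assume "is_path G Q \<and> hd Q = hd [v] \<and> last Q = last [v]"
    then show "length [v] \<le> length Q" by (auto simp: is_path_def Suc_le_eq)
  next
    fix Q assume Q: "is_path G Q \<and> hd Q = hd [v] \<and> last Q = last [v] \<and> length Q = length [v]"
    then obtain w where "Q = [w]" by (auto simp: length_Suc_conv)
    then show "Q = [v]" using Q by simp
  qed simp
  then have ne: "?S \<noteq> {}" by blast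
  have "length P \<le> card (verts G)" if "is_usp G P" for P
    using that wf unfolding is_usp_def is_path_def wf_graph_def
    by (metis card_mono distinct_card)
  then have "?S \<subseteq> {..card (verts G)}" by auto
  then have "finite ?S" by (rule finite_subset) simp
  then have "usp G \<in> ?S" unfolding usp_def using Max_in ne by blast
  then show ?thesis by auto
qed

lemma sp_layout:
  assumes wf: "wf_graph G"
  shows "\<exists>Q l. layout G Q l \<and> card Q + sp G = card (verts G)"
proof -
  obtain Q where Q: "is_usp G Q" "length Q = usp G" using usp_attained[OF wf] by blast
  obtain l where l: "layout G (set Q) l" using usp_layout[OF wf Q(1)] by blast
  have "card (set Q) = usp G" using Q by (simp add: is_usp_def is_path_def distinct_card)
  moreover have "card (set Q) \<le> card (verts G)"
    using l wf unfolding layout_def wf_graph_def by (meson card_mono)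
  ultimately have "card (set Q) + sp G = card (verts G)" by (simp add: sp_def)
  then show ?thesis using l by blast
qed

section \<open>Layouts of crowded parades\<close>

text \<open>Parade vertex \<open>v i\<close> sits at position \<open>2 * i\<close>, a spectator adjacent to \<open>v i\<close> and
\<open>v (Suc i)\<close> at position \<open>2 * i + 1\<close>; crowdedness makes vertices whose positions
differ by at most two adjacent.\<close>
locale crowded_positions =
  fixes G :: mgraph and p :: nat and v :: "nat \<Rightarrow> nat" and pos :: "nat \<Rightarrow> nat"
  assumes p2: "2 \<le> p"
    and pos_le: "z \<in> verts G \<Longrightarrow> pos z \<le> 2 * (p - 1)"
    and v_verts: "i < p \<Longrightarrow> v i \<in> verts G"
    and pos_v: "i < p \<Longrightarrow> pos (v i) = 2 * i"
    and even_pos: "z \<in> verts G \<Longrightarrow> even (pos z) \<Longrightarrow> v (pos z div 2) = z"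
    and near_adj: "\<lbrakk>z \<in> verts G; w \<in> verts G; z \<noteq> w; pos z \<le> pos w + 2; pos w \<le> pos z + 2\<rbrakk>
      \<Longrightarrow> adj G z w"
begin

text \<open>Reading the parade from its other end; thus only one orientation of a layout has to be
  analysed.\<close>

lemma reverse: "crowded_positions G p (\<lambda>i. v (p - 1 - i)) (\<lambda>z. 2 * (p - 1) - pos z)"
proof
  show "2 \<le> p" by (rule p2)
  fix z assume z: "z \<in> verts G"
  show "2 * (p - 1) - pos z \<le> 2 * (p - 1)" by simp
  show "v (p - 1 - (2 * (p - 1) - pos z) div 2) = z" if "even (2 * (p - 1) - pos z)"
  proof -
    have "even (pos z)" using that pos_le[OF z] by simp
    then have "p - 1 - (2 * (p - 1) - pos z) div 2 = pos z div 2" using pos_le[OF z] by auto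
    then show ?thesis using even_pos[OF z \<open>even (pos z)\<close>] by simp
  qed
  fix w assume "w \<in> verts G" "z \<noteq> w" "2 * (p - 1) - pos z \<le> 2 * (p - 1) - pos w + 2"
     "2 * (p - 1) - pos w \<le> 2 * (p - 1) - pos z + 2"
  moreover from this have "pos z \<le> pos w + 2" "pos w \<le> pos z + 2"
    using pos_le[OF z] pos_le[of w] by linarith+
  ultimately show "adj G z w" using near_adj z by blast
next
  fix i assume "i < p"
  then show "v (p - 1 - i) \<in> verts G" "2 * (p - 1) - pos (v (p - 1 - i)) = 2 * i"
    using v_verts pos_v by auto
qed

section \<open>Levels compared with positions\<close>

context
  fixes l :: "nat \<Rightarrow> nat"
  assumes lip: "\<And>x y. adj G x y \<Longrightarrow> l x \<le> l y + 1"
begin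

lemma near_lip:
  "\<lbrakk>z \<in> verts G; w \<in> verts G; pos z \<le> pos w; pos w \<le> pos z + 2\<rbrakk> \<Longrightarrow> l z \<le> l w + 1 \<and> l w \<le> l z + 1"
  using near_adj[of z w] near_adj[of w z] lip by (cases "z = w") auto

lemma parade_lip: "i + t < p \<Longrightarrow> l (v i) \<le> l (v (i + t)) + t \<and> l (v (i + t)) \<le> l (v i) + t"
proof (induction t)
  case (Suc t)
  have "l (v (i + t)) \<le> l (v (i + Suc t)) + 1 \<and> l (v (i + Suc t)) \<le> l (v (i + t)) + 1"
    using Suc.prems by (intro near_lip) (auto simp: v_verts pos_v)
  then show ?case using Suc by auto
qed simp

text \<open>For positions more than two apart, the bound is the length of a route from
  \<open>z\<close> to \<open>w\<close>: at most one step up to a parade vertex \<open>v h\<close>,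
  then along the parade to \<open>v k\<close>, then at most one step to \<open>w\<close>.\<close>

lemma dist_bound:
  assumes zw: "z \<in> verts G" "w \<in> verts G" "pos z \<le> pos w"
  shows "l z \<le> l w + ((pos w + 1) div 2 - pos z div 2)
    \<and> l w \<le> l z + ((pos w + 1) div 2 - pos z div 2)"
proof (cases "pos w \<le> pos z + 2")
  case True
  show ?thesis
  proof (cases "z = w")
    case False
    then have "pos z \<noteq> pos w \<or> odd (pos z)" using even_pos zw by metis
    then have "1 \<le> (pos w + 1) div 2 - pos z div 2" using zw(3) by presburger
    then show ?thesis using near_lip[OF zw True] by linarith
  qed simp
next
  case False
  define h k where "h = (pos z + 1) div 2" and "k = pos w div 2"
  have hk: "h \<le> k" "k < p" using False pos_le[OF zw(2)] p2 by (auto simp: h_def k_def)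
  have "l z \<le> l (v h) + (h - pos z div 2) \<and> l (v h) \<le> l z + (h - pos z div 2)"
  proof (cases "even (pos z)")
    case True
    then show ?thesis using even_pos[OF zw(1)] by (simp add: h_def)
  next
    case odd: False
    then have "h - pos z div 2 = 1" "pos z \<le> 2 * h" "2 * h \<le> pos z + 2" by (auto simp: h_def elim!: oddE)
    then show ?thesis using near_lip[OF zw(1) v_verts[of h]] pos_v[of h] hk by simp
  qed
  moreover have "l w \<le> l (v k) + ((pos w + 1) div 2 - k) \<and> l (v k) \<le> l w + ((pos w + 1) div 2 - k)"
  proof (cases "even (pos w)")
    case True
    then show ?thesis using even_pos[OF zw(2)] by (simp add: k_def)
  next
    case odd: False
    then have "(pos w + 1) div 2 - k = 1" "2 * k \<le> pos w" "pos w \<le> 2 * k + 2" by (auto simp: k_def elim!: oddE)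
    then show ?thesis using near_lip[OF v_verts[of k] zw(2)] pos_v[of k] hk by simp
  qed
  moreover have "l (v h) \<le> l (v k) + (k - h) \<and> l (v k) \<le> l (v h) + (k - h)"
    using parade_lip[of h "k - h"] hk by simp
  moreover have "(h - pos z div 2) + (k - h) + ((pos w + 1) div 2 - k) = (pos w + 1) div 2 - pos z div 2"
    using hk by (auto simp: h_def k_def)
  ultimately show ?thesis by linarith
qed

lemma diameter: "z \<in> verts G \<Longrightarrow> w \<in> verts G \<Longrightarrow> l z \<le> l w + (p - 1)"
  using dist_bound[of z w] dist_bound[of w z] pos_le[of z] pos_le[of w] by linarith

text \<open>A level difference of \<open>p - 1\<close> makes \<open>dist_bound\<close> tight, which
  leaves only the first two and the last two positions; \<open>2 * p \<le> pos y + 3\<close> puts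
  \<open>y\<close> at position \<open>2 * (p - 1) - 1\<close> or later.\<close>

lemma antipodal:
  assumes xy: "x \<in> verts G" "y \<in> verts G" "l y = l x + (p - 1)" and p3: "3 \<le> p"
  shows "pos x \<le> 1 \<and> 2 * p \<le> pos y + 3 \<or> pos y \<le> 1 \<and> 2 * p \<le> pos x + 3"
proof -
  have "pos y div 2 = 0 \<and> (pos x + 1) div 2 = p - 1" if "pos y \<le> pos x"
    using dist_bound[OF xy(2,1) that] xy(3) p3 pos_le[OF xy(1)] by linarith
  moreover have "pos x div 2 = 0 \<and> (pos y + 1) div 2 = p - 1" if "pos x \<le> pos y"
    using dist_bound[OF xy(1,2) that] xy(3) p3 pos_le[OF xy(2)] by linarith
  ultimately show ?thesis by linarith
qed

end

section \<open>Size and rigidity of layouts\<close>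

text \<open>Injectivity puts \<open>card Q\<close> distinct levels between the least and the
  greatest level on \<open>Q\<close>, and \<open>diameter\<close> bounds their difference.\<close>

lemma extremes:
  assumes QV: "Q \<subseteq> verts G" and inj: "inj_on l Q" and lip: "\<And>x y. adj G x y \<Longrightarrow> l x \<le> l y + 1"
    and fin: "finite Q" and ne: "Q \<noteq> {}"
  shows "\<exists>x\<in>Q. \<exists>y\<in>Q. card Q \<le> l y - l x + 1 \<and> l y \<le> l x + (p - 1) \<and> (\<forall>z\<in>Q. l x \<le> l z \<and> l z \<le> l y)"
proof -
  obtain x where x: "x \<in> Q" "\<And>z. z \<in> Q \<Longrightarrow> l x \<le> l z"
    using ne fin by (metis arg_min_if_finite(1) arg_min_least)
  have "Max (l ` Q) \<in> l ` Q" using fin ne by simp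
  then obtain y where y: "y \<in> Q" "l y = Max (l ` Q)" by auto
  have y_max: "l z \<le> l y" if "z \<in> Q" for z using that y(2) fin by simp
  have "card Q = card (l ` Q)" using inj by (simp add: card_image)
  also have "\<dots> \<le> card {l x..l y}" using x y_max by (intro card_mono) auto
  also have "\<dots> = l y - l x + 1" using x(2)[OF y(1)] by simp
  finally show ?thesis using x y y_max diameter[of l, OF lip] QV by blast
qed

text \<open>Levels of a supergraph \<open>H\<close> still change by at most one along edges of
  \<open>G\<close>, so the diameter of \<open>G\<close> bounds the layouts of
  \<open>H\<close>.\<close>

lemma layout_card:
  assumes "layout H Q l" "wf_graph H" "verts H = verts G" "\<And>x y. mult G x y \<le> mult H x y"
  shows "card Q \<le> p"
proof (cases "Q = {}")
  case False
  have "finite Q" using assms unfolding layout_def wf_graph_def by (metis finite_subset)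
  moreover have "\<And>x y. adj G x y \<Longrightarrow> adj H x y" using assms(4) unfolding adj_def by (meson le_trans)
  ultimately show ?thesis
    using extremes[of Q l] assms(1,3) False p2 unfolding layout_def by fastforce
qed simp

text \<open>The levels of the inner parade vertices are forced by the two ends of \<open>Q\<close>. They then lie in \<open>Q\<close>,
by descending induction, because a spectator cannot be adjacent to a vertex of \<open>Q\<close> of higher level.
Hence every vertex has level \<open>l x + (pos z + 1) div 2\<close>, except that \<open>x\<close> and \<open>v 0\<close> may be swapped.\<close>
lemma rigid_oriented:
  assumes lay: "layout H Q l" and wf: "wf_graph H" and V: "verts H = verts G"
    and GH: "\<And>x y. adj G x y \<Longrightarrow> adj H x y"
    and xy: "x \<in> Q" "y \<in> Q" "l y = l x + (p - 1)"
    and extr: "\<And>z. z \<in> Q \<Longrightarrow> l x \<le> l z \<and> l z \<le> l y"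
    and px: "pos x \<le> 1" and py: "2 * p \<le> pos y + 3" and p3: "3 \<le> p"
  shows "\<And>z w. adj H z w \<Longrightarrow> adj G z w"
    and "\<And>i. 1 \<le> i \<Longrightarrow> i \<le> p - 2 \<Longrightarrow> v i \<in> Q"
    and "adj G x (v 1)" "adj G (v (p - 2)) y"
proof -
  have QV: "Q \<subseteq> verts G" and inj: "inj_on l Q" and lipH: "\<And>x y. adj H x y \<Longrightarrow> l x \<le> l y + 1"
    and spec: "\<And>x y. adj H x y \<Longrightarrow> x \<notin> Q \<Longrightarrow> y \<in> Q \<Longrightarrow> l y \<le> l x"
    using lay V unfolding layout_def by auto
  have lip: "\<And>x y. adj G x y \<Longrightarrow> l x \<le> l y + 1" using lipH GH by blast
  note near = near_lip[of l, OF lip] and plip = parade_lip[of l, OF lip]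
  have near_spec: "l w \<le> l z"
    if "z \<in> verts G" "w \<in> Q" "z \<notin> Q" "pos z \<le> pos w + 2" "pos w \<le> pos z + 2" for z w
  proof -
    have "adj G z w" using near_adj[of z w] that QV by blast
    then show ?thesis using spec GH that by blast
  qed
  define a where "a = l x"
  have xV: "x \<in> verts G" and yV: "y \<in> verts G" using xy QV by auto
  show x1: "adj G x (v 1)" using near_adj[of x "v 1"] xV v_verts[of 1] pos_v[of 1] px p3 by fastforce
  show y1: "adj G (v (p - 2)) y"
    using near_adj[of "v (p - 2)" y] yV v_verts[of "p - 2"] pos_v[of "p - 2"] py p3 pos_le[OF yV]
    by fastforce
  \<comment> \<open>The route from \<open>x\<close> through \<open>v 1\<close>, ...,
    \<open>v (p - 2)\<close> to \<open>y\<close> has \<open>p - 1\<close> steps and gains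
    \<open>p - 1\<close> levels, so every step gains exactly one.\<close>
  have lv: "l (v i) = a + i" if i: "1 \<le> i" "i \<le> p - 2" for i
  proof -
    have "l (v i) \<le> l (v 1) + (i - 1)" using plip[of 1 "i - 1"] i p3 by simp
    moreover have "l (v 1) \<le> a + 1"
      using near[of x "v 1"] xV v_verts[of 1] pos_v[of 1] px p3 by (simp add: a_def)
    moreover have "l (v (p - 2)) \<le> l (v i) + (p - 2 - i)" using plip[of i "p - 2 - i"] i p3 by simp
    moreover have "l y \<le> l (v (p - 2)) + 1"
      using near[of "v (p - 2)" y] yV v_verts[of "p - 2"] pos_v[of "p - 2"] py p3 pos_le[OF yV] by simp
    ultimately show ?thesis using i xy(3) p3 by (simp add: a_def)
  qed
  show vQ: "v i \<in> Q" if i: "1 \<le> i" "i \<le> p - 2" for i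
    using i(2,1)
  proof (induction rule: inc_induct)
    case base
    show ?case
    proof (rule ccontr)
      assume "v (p - 2) \<notin> Q"
      then have "l y \<le> l (v (p - 2))"
        using near_spec[of "v (p - 2)" y] xy py p3 pos_le[OF yV] v_verts[of "p - 2"] pos_v[of "p - 2"] by simp
      then show False using lv[of "p - 2"] xy(3) p3 by (simp add: a_def)
    qed
  next
    case (step j)
    show ?case
    proof (rule ccontr)
      assume "v j \<notin> Q"
      then have "l (v (Suc j)) \<le> l (v j)"
        using near_spec[of "v j" "v (Suc j)"] step p3 v_verts[of j] pos_v[of j] pos_v[of "Suc j"] by simp
      then show False using lv[of j] lv[of "Suc j"] step by simp
    qed
  qed
  have Q_cases: "z = x \<or> z = y \<or> (\<exists>i. 1 \<le> i \<and> i \<le> p - 2 \<and> z = v i)" if "z \<in> Q" for z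
  proof -
    define t where "t = l z - a"
    have t: "l z = a + t" "t \<le> p - 1" using extr[OF that] xy(3) by (auto simp: t_def a_def)
    consider "t = 0" | "t = p - 1" | "1 \<le> t" "t \<le> p - 2" using t(2) by linarith
    then show ?thesis
    proof cases
      case 1
      then have "z = x" using inj t(1) that xy(1) by (auto simp: a_def inj_on_def)
      then show ?thesis by blast
    next
      case 2
      then have "z = y" using inj t(1) that xy(2,3) by (auto simp: a_def inj_on_def)
      then show ?thesis by blast
    next
      case 3
      then have "z = v t" using inj t(1) that vQ[OF 3] lv[OF 3] by (auto simp: inj_on_def)
      then show ?thesis using 3 by blast
    qed
  qed
  \<comment> \<open>If \<open>x\<close> is at position 1, it still has level \<open>a\<close>, and
    \<open>v 0\<close> may have level \<open>a + 1\<close>; hence the two exceptions.\<close>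
  have level: "l z = a + (pos z + 1) div 2" if z: "z \<in> verts G" "z \<noteq> x" "pos z \<noteq> 0" for z
  proof (cases "z = y")
    case True
    then have "pos z + 1 = 2 * (p - 1) \<or> pos z + 1 = 2 * (p - 1) + 1"
      using py pos_le[OF yV] p3 unfolding True by linarith
    then have "(pos z + 1) div 2 = p - 1" by auto
    then show ?thesis using True xy(3) by (simp add: a_def)
  next
    case zy: False
    show ?thesis
    proof (cases "even (pos z)")
      case True
      define i where "i = pos z div 2"
      have i: "pos z = 2 * i" "z = v i" "1 \<le> i" "i \<le> p - 1"
        using True even_pos[OF z(1)] z(3) pos_le[OF z(1)] by (auto simp: i_def)
      show ?thesis
      proof (cases "i \<le> p - 2")
        case True
        then show ?thesis using lv i by simp
      next
        case False
        then have ip: "i = p - 1" using i by simp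
        \<comment> \<open>Here \<open>z = v (p - 1)\<close> differs from \<open>y\<close>, so it is
          a spectator, and its neighbours \<open>y\<close> and \<open>v (p - 2)\<close> squeeze its
          level.\<close>
        have "z \<notin> Q"
        proof
          assume "z \<in> Q"
          then obtain j where "j \<le> p - 2" "z = v j" using Q_cases zy z by blast
          then show False using pos_v[of j] i ip p3 by simp
        qed
        then have "l y \<le> l z" using near_spec[of z y] z xy py pos_le[OF yV] ip i p3 by simp
        moreover have "l z \<le> l (v (p - 2)) + 1"
          using near[of "v (p - 2)" z] v_verts[of "p - 2"] pos_v[of "p - 2"] z i ip p3 by simp
        moreover have "l (v (p - 2)) = a + (p - 2)" using lv[of "p - 2"] p3 by linarith
        ultimately have "l z = a + (p - 1)" using xy(3) p3 by (simp add: a_def)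
        then show ?thesis using i(1) ip by simp
      qed
    next
      case False
      then obtain i where i: "pos z = 2 * i + 1" by (elim oddE)
      then have ip: "i \<le> p - 2" using pos_le[OF z(1)] by simp
      have "z \<notin> Q"
      proof
        assume "z \<in> Q"
        then obtain j where "j \<le> p - 2" "z = v j" using Q_cases zy z by blast
        then have "pos z = 2 * j" using pos_v[of j] p3 by simp
        then show False using i by presburger
      qed
      have "a + i + 1 \<le> l z"
      proof (cases "i = p - 2")
        case True
        then have "l y \<le> l z"
          using near_spec[of z y] \<open>z \<notin> Q\<close> z xy py pos_le[OF yV] i p3 by simp
        then show ?thesis using True xy(3) p3 by (simp add: a_def)
      next
        case False
        then have "l (v (i + 1)) \<le> l z"
          using near_spec[of z "v (i + 1)"] \<open>z \<notin> Q\<close> z vQ[of "i + 1"] pos_v[of "i + 1"] i ip p3 by simp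
        then show ?thesis using lv[of "i + 1"] False ip by simp
      qed
      moreover have "l z \<le> a + i + 1"
      proof (cases "i = 0")
        case True
        then have "l z \<le> l x + 1" using near[of x z] xV z px i by simp
        then show ?thesis using True by (simp add: a_def)
      next
        case False
        then have "l z \<le> l (v i) + 1"
          using near[of "v i" z] v_verts[of i] pos_v[of i] z i ip p3 by simp
        then show ?thesis using lv[of i] False ip by simp
      qed
      ultimately show ?thesis using i by simp
    qed
  qed
  \<comment> \<open>Positions at most two apart are adjacent in \<open>G\<close> already, so a new
    edge of \<open>H\<close> would join positions at least three apart.\<close>
  have no_far: False if zw: "adj H z w" "pos z + 3 \<le> pos w" for z w
  proof -
    have zV: "z \<in> verts G" and wV: "w \<in> verts G" using adj_verts[OF wf zw(1)] V by auto
    have lw: "l w = a + (pos w + 1) div 2" using level[OF wV] zw(2) px by (cases "w = x") auto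
    have wz: "l w \<le> l z + 1" using lipH adj_sym[OF wf] zw(1) by blast
    have zy: "z \<noteq> y" using zw(2) py pos_le[OF wV] p3 by auto
    \<comment> \<open>A spectator has no neighbour in \<open>Q\<close> of higher level, so
      \<open>w\<close> is not in \<open>Q\<close>, while all inner parade vertices are. Hence
      \<open>w = v (p - 1)\<close>, and \<open>y\<close> replaces it from position
      \<open>2 * p - 3\<close>.\<close>
    have even_w: "w \<notin> Q \<and> pos w = 2 * (p - 1) \<and> pos y + 3 = 2 * p" if "even (pos w)" "z \<notin> Q" "l z < l w"
    proof -
      have "w \<notin> Q" using spec[OF zw(1) that(2)] that(3) by auto
      define i where "i = pos w div 2"
      have i: "pos w = 2 * i" "w = v i" "2 \<le> i" "i \<le> p - 1"
        using that even_pos[OF wV] zw(2) pos_le[OF wV] by (auto simp: i_def)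
      have "i = p - 1" using \<open>w \<notin> Q\<close> vQ[of i] i by fastforce
      moreover have "pos y \<noteq> 2 * (p - 1)"
      proof
        assume "pos y = 2 * (p - 1)"
        then have "y = w" using even_pos[OF yV] i \<open>i = p - 1\<close> by simp
        then show False using \<open>w \<notin> Q\<close> xy by simp
      qed
      ultimately show ?thesis using \<open>w \<notin> Q\<close> i py pos_le[OF yV] by simp
    qed
    consider "z = x" | "z \<noteq> x" "pos z = 0" | "z \<noteq> x" "pos z \<noteq> 0" by blast
    then show False
    proof cases
      case 1
      then have "l w \<le> a + 1" using wz by (simp add: a_def)
      then show False using lw zw(2) by linarith
    next
      \<comment> \<open>Here \<open>z = v 0\<close> and \<open>x\<close> is at position 1. Levels
        leave \<open>w\<close> the positions 3 and 4, and position 4 puts \<open>y\<close> at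
        position 3. Either way a vertex two positions from \<open>x\<close> would be two levels
        above it.\<close>
      case 2
      have "pos x = 1"
      proof (rule ccontr)
        assume "pos x \<noteq> 1"
        then have "pos x = 0" using px by simp
        then show False using even_pos[OF xV] even_pos[OF zV] 2 by simp
      qed
      have zQ: "z \<notin> Q"
      proof
        assume "z \<in> Q"
        then obtain j where "1 \<le> j" "j \<le> p - 2" "z = v j" using Q_cases zy 2 by blast
        then show False using pos_v[of j] 2 p3 by simp
      qed
      have "l z \<le> a + 1" using near[of z x] zV xV 2 px by (simp add: a_def)
      then have "l w \<le> a + 2" using wz by simp
      then have "pos w = 3 \<or> pos w = 4" using lw zw(2) by linarith
      then show False
      proof
        assume w3: "pos w = 3"
        then have "l w \<le> l x + 1" using near[of x w] xV wV \<open>pos x = 1\<close> by simp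
        then show False using lw w3 by (simp add: a_def)
      next
        assume w4: "pos w = 4"
        then have "pos w = 2 * (p - 1) \<and> pos y + 3 = 2 * p" using even_w zQ lw \<open>l z \<le> a + 1\<close> by simp
        then have "p = 3" "pos y = 3" using w4 by auto
        then have "l y \<le> l x + 1" using near[of x y] xV yV \<open>pos x = 1\<close> by simp
        then show False using xy(3) \<open>p = 3\<close> by simp
      qed
    next
      \<comment> \<open>Levels at most one apart allow only odd \<open>pos z\<close> with
        \<open>pos w = pos z + 3\<close>. Then \<open>y\<close> is two positions after the spectator
        \<open>z\<close> and one level above it, which is impossible.\<close>
      case 3
      have lz: "l z = a + (pos z + 1) div 2" using level[OF zV] 3 by simp
      have "(pos w + 1) div 2 \<le> (pos z + 1) div 2 + 1" using lw lz wz by simp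
      then have odd_z: "odd (pos z)" and w: "pos w = pos z + 3" using zw(2) by presburger+
      have zQ: "z \<notin> Q"
      proof
        assume "z \<in> Q"
        then obtain j where "j \<le> p - 2" "z = v j" using Q_cases zy 3 by blast
        then have "pos z = 2 * j" using pos_v[of j] p3 by simp
        then show False using odd_z by simp
      qed
      have "even (pos w)" using odd_z w by simp
      moreover have "l z < l w" using lz lw w by simp
      ultimately have wp: "pos w = 2 * (p - 1)" "pos y + 3 = 2 * p" using even_w zQ by auto
      then have "pos y = pos z + 2" using w p3 by simp
      then have "l y \<le> l z" using near_spec[of z y] zV xy zQ by simp
      then show False using lz xy(3) wp w p3 by (simp add: a_def)
    qed
  qed
  show "adj G z w" if zw: "adj H z w" for z w
  proof -
    have "z \<in> verts G" "w \<in> verts G" "z \<noteq> w" using adj_verts[OF wf zw] V by auto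
    moreover have "\<not> pos z + 3 \<le> pos w" "\<not> pos w + 3 \<le> pos z"
      using no_far zw adj_sym[OF wf] by blast+
    ultimately show ?thesis using near_adj[of z w] by linarith
  qed
qed

text \<open>If \<open>x\<close> were at an odd position, at least two edges would join it to
  \<open>v 1\<close>, which is also in \<open>Q\<close>; a layout forbids this, and likewise for
  \<open>y\<close>. So the ends are \<open>v 0\<close> and \<open>v (p - 1)\<close>, and the whole
  parade lies in \<open>Q\<close>.\<close>

lemma parade_mult_oriented:
  assumes lay: "layout H Q l" and xy: "x \<in> Q" "y \<in> Q"
    and inner: "\<And>i. 1 \<le> i \<Longrightarrow> i \<le> p - 2 \<Longrightarrow> v i \<in> Q"
    and adj: "adj G x (v 1)" "adj G y (v (p - 2))" and p3: "3 \<le> p"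
    and px: "pos x \<le> 1" and py: "2 * p \<le> pos y + 3" and QV: "Q \<subseteq> verts G"
    and GH: "\<And>x y. mult G x y \<le> mult H x y"
    and dbl: "\<And>z w. adj G z w \<Longrightarrow> odd (pos z) \<Longrightarrow> 2 \<le> mult G z w" and i: "Suc i < p"
  shows "mult H (v i) (v (Suc i)) \<le> 1"
proof -
  have one: "mult H z w \<le> 1" if "z \<in> Q" "w \<in> Q" for z w using lay that by (simp add: layout_def)
  have ev: "even (pos z)" if "adj G z w" "z \<in> Q" "w \<in> Q" for z w
    using dbl[of z w] one[of z w] GH[of z w] that by fastforce
  have "even (pos x)" "even (pos y)" using ev adj xy inner[of 1] inner[of "p - 2"] p3 by auto
  moreover from this have "pos x = 0" "pos y = 2 * (p - 1)"
    using px py pos_le[of y] xy QV by (auto elim!: evenE)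
  ultimately have "v 0 = x" "v (p - 1) = y" using even_pos[of x] even_pos[of y] xy QV by auto
  then have "v j \<in> Q" if "j < p" for j
    using that xy inner[of j] by (cases "j = 0"; cases "j = p - 1") auto
  then show ?thesis using one i by simp
qed

text \<open>\<open>antipodal\<close> leaves two orientations, and \<open>reverse\<close> turns the
  second into the first; for \<open>p = 2\<close> all vertices are pairwise adjacent in
  \<open>G\<close>. Doubling is a premise of the second conclusion only, so the first also serves
  simple graphs.\<close>

lemma rigid:
  assumes lay: "layout H Q l" and wf: "wf_graph H" "wf_graph G" and V: "verts H = verts G"
    and GH: "\<And>x y. mult G x y \<le> mult H x y" and card: "p \<le> card Q"
  shows "\<And>z w. adj H z w \<Longrightarrow> adj G z w"
    and "\<And>i. \<lbrakk>\<And>z w. adj G z w \<Longrightarrow> odd (pos z) \<Longrightarrow> 2 \<le> mult G z w; Suc i < p\<rbrakk>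
       \<Longrightarrow> mult H (v i) (v (Suc i)) \<le> 1"
proof -
  have QV: "Q \<subseteq> verts G" and inj: "inj_on l Q" and lipH: "\<And>x y. adj H x y \<Longrightarrow> l x \<le> l y + 1"
    and one: "\<And>x y. x \<in> Q \<Longrightarrow> y \<in> Q \<Longrightarrow> mult H x y \<le> 1"
    using lay V unfolding layout_def by auto
  have GHadj: "\<And>x y. adj G x y \<Longrightarrow> adj H x y" using GH unfolding adj_def by (meson le_trans)
  then have lip: "\<And>x y. adj G x y \<Longrightarrow> l x \<le> l y + 1" using lipH by blast
  have fin: "finite Q" using QV wf unfolding wf_graph_def by (meson finite_subset)
  have ne: "Q \<noteq> {}" using card p2 by auto
  obtain x y where xy: "x \<in> Q" "y \<in> Q" "card Q \<le> l y - l x + 1" "l y \<le> l x + (p - 1)"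
    and extr: "\<And>z. z \<in> Q \<Longrightarrow> l x \<le> l z \<and> l z \<le> l y"
    using extremes[OF QV inj lip fin ne] by blast
  have ly: "l y = l x + (p - 1)" using xy card p2 by linarith
  have xyV: "x \<in> verts G" "y \<in> verts G" using xy QV by auto
  have "(\<forall>z w. adj H z w \<longrightarrow> adj G z w) \<and>
    ((\<forall>z w. adj G z w \<longrightarrow> odd (pos z) \<longrightarrow> 2 \<le> mult G z w) \<longrightarrow>
      (\<forall>i. Suc i < p \<longrightarrow> mult H (v i) (v (Suc i)) \<le> 1))"
  proof (cases "3 \<le> p")
    case p3: True
    from antipodal[of l, OF lip xyV ly p3] show ?thesis
    proof
      assume a: "pos x \<le> 1 \<and> 2 * p \<le> pos y + 3"
      note r = rigid_oriented[OF lay wf(1) V GHadj xy(1,2) ly extr _ _ p3]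
      show ?thesis
        using r parade_mult_oriented[OF lay xy(1,2) r(2) r(3) adj_sym[OF wf(2) r(4)] p3 _ _ QV GH] a
        by blast
    next
      assume a: "pos y \<le> 1 \<and> 2 * p \<le> pos x + 3"
      interpret R: crowded_positions G p "\<lambda>i. v (p - 1 - i)" "\<lambda>z. 2 * (p - 1) - pos z" by (rule reverse)
      have b: "2 * (p - 1) - pos x \<le> 1" "2 * p \<le> 2 * (p - 1) - pos y + 3" using a p3 by auto
      note r = R.rigid_oriented[OF lay wf(1) V GHadj xy(1,2) ly extr b p3]
      note m = R.parade_mult_oriented[OF lay xy(1,2) r(2) r(3) adj_sym[OF wf(2) r(4)] p3 b QV GH]
      have "mult H (v i) (v (Suc i)) \<le> 1"
        if d: "\<forall>z w. adj G z w \<longrightarrow> odd (pos z) \<longrightarrow> 2 \<le> mult G z w" and i: "Suc i < p" for i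
      proof -
        have "odd (pos z)" if "adj G z w" "odd (2 * (p - 1) - pos z)" for z w
          using that pos_le[of z] adj_verts[OF wf(2) that(1)] by auto
        \<comment> \<open>Edge \<open>i\<close> of the parade is edge \<open>p - 2 - i\<close> of
          the reversed parade, traversed backwards.\<close>
        then have "mult H (v (p - 1 - (p - 2 - i))) (v (p - 1 - Suc (p - 2 - i))) \<le> 1"
          using d i by (intro m) auto
        moreover have "p - 1 - (p - 2 - i) = Suc i" "p - 1 - Suc (p - 2 - i) = i" using i by auto
        ultimately show ?thesis using wf(1) unfolding wf_graph_def by metis
      qed
      then show ?thesis using r(1) by blast
    qed
  next
    case False
    then have p: "p = 2" using p2 by simp
    have near: "pos z \<le> pos w + 2" if "z \<in> verts G" for z w using pos_le[OF that] p by simp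
    have all: "adj G z w" if "z \<in> verts G" "w \<in> verts G" "z \<noteq> w" for z w
      using near_adj[of z w] near that by blast
    have "mult H (v i) (v (Suc i)) \<le> 1"
      if d: "\<forall>z w. adj G z w \<longrightarrow> odd (pos z) \<longrightarrow> 2 \<le> mult G z w" and i: "Suc i < p" for i
    proof -
      have "x \<noteq> y" using ly p by auto
      have no: "\<not> 2 \<le> mult G z w" if "z \<in> Q" "w \<in> Q" for z w
        using one[OF that] GH[of z w] by simp
      have ev: "even (pos x)" "even (pos y)"
        using d all[of x y] all[of y x] xyV \<open>x \<noteq> y\<close> no xy(1,2) by metis+
      have "z = v 0 \<or> z = v 1" if "z \<in> verts G" "even (pos z)" for z
      proof -
        have "pos z div 2 = 0 \<or> pos z div 2 = 1" using pos_le[OF that(1)] p by auto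
        then show ?thesis using even_pos[OF that] by auto
      qed
      then have "x = v 0 \<or> x = v 1" "y = v 0 \<or> y = v 1" using ev xyV by blast+
      then have "v 0 \<in> Q" "v 1 \<in> Q" using \<open>x \<noteq> y\<close> xy by auto
      then show ?thesis using one i p by simp
    qed
    then show ?thesis using all adj_verts[OF wf(1)] V by blast
  qed
  then show "\<And>z w. adj H z w \<Longrightarrow> adj G z w"
    and "\<And>i. \<lbrakk>\<And>z w. adj G z w \<Longrightarrow> odd (pos z) \<Longrightarrow> 2 \<le> mult G z w; Suc i < p\<rbrakk>
       \<Longrightarrow> mult H (v i) (v (Suc i)) \<le> 1" by blast+
qed

end

section \<open>Saturated crowded parades\<close>

text \<open>The two parade neighbours of a spectator are adjacent, so their levels differ by one and
  they are consecutive on \<open>P\<close>; this gives each spectator a position.\<close>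

lemma crowded_positions_exist:
  assumes wf: "wf_graph G" and P: "is_usp G P" "2 \<le> length P" and cr: "crowded_wrt G P"
  shows "\<exists>pos. crowded_positions G (length P) ((!) P) pos \<and> (\<forall>z\<in>set P. even (pos z))"
proof -
  let ?p = "length P"
  have path: "is_path G P" using P by (simp add: is_usp_def)
  have dist: "distinct P" and PV: "set P \<subseteq> verts G" using path by (auto simp: is_path_def)
  obtain l where lay: "layout G (set P) l" and l: "\<And>i. i < ?p \<Longrightarrow> l (P ! i) = Suc i"
    using usp_layout[OF wf P(1)] by blast
  have lip: "\<And>x y. adj G x y \<Longrightarrow> l x \<le> l y + 1" using lay by (simp add: layout_def)
  have ends: "\<exists>i. Suc i < ?p \<and> adj G z (P ! i) \<and> adj G z (P ! Suc i)"
    if z: "z \<in> verts G" "z \<notin> set P" for z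
  proof -
    have "card {y \<in> set P. adj G z y} = 2" using cr z by (simp add: crowded_wrt_def)
    then obtain a b where ab: "{y \<in> set P. adj G z y} = {a, b}" "a \<noteq> b" by (meson card_2_iff)
    then have mem: "a \<in> set P" "adj G z a" "b \<in> set P" "adj G z b" by blast+
    then have adj: "adj G a b" "adj G b a" using cr z ab(2) unfolding crowded_wrt_def by blast+
    obtain i j where ij: "i < ?p" "a = P ! i" "j < ?p" "b = P ! j" using mem by (metis in_set_conv_nth)
    then have "i \<noteq> j" "i \<le> j + 1" "j \<le> i + 1" using lip[OF adj(1)] lip[OF adj(2)] l ab(2) by auto
    then have "i = Suc j \<or> j = Suc i" by linarith
    then show ?thesis using ij mem by auto
  qed
  define side where "side z = (SOME i. Suc i < ?p \<and> adj G z (P ! i) \<and> adj G z (P ! Suc i))" for z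
  have side: "Suc (side z) < ?p \<and> adj G z (P ! side z) \<and> adj G z (P ! Suc (side z))"
    if z: "z \<in> verts G" "z \<notin> set P" for z
    unfolding side_def by (rule someI_ex) (rule ends[OF z])
  \<comment> \<open>Levels on the parade start at 1, hence \<open>l z - 1\<close>;
    \<open>side z\<close> is the lower index of the two parade neighbours.\<close>
  define pos where "pos z = (if z \<in> set P then 2 * (l z - 1) else 2 * side z + 1)" for z
  have pos_nth: "pos (P ! i) = 2 * i" if "i < ?p" for i using that l by (simp add: pos_def)
  have near: "adj G z w \<and> adj G w z"
    if zw: "z \<in> verts G" "w \<in> verts G" "z \<noteq> w" "pos z \<le> pos w" "pos w \<le> pos z + 2" for z w
  proof -
    have "adj G z w"
    proof (cases "z \<in> set P"; cases "w \<in> set P")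
      assume "z \<in> set P" "w \<in> set P"
      then obtain i j where ij: "i < ?p" "z = P ! i" "j < ?p" "w = P ! j" by (metis in_set_conv_nth)
      then have "j = Suc i" using zw pos_nth by (cases "i = j") auto
      then show ?thesis using path ij by (simp add: is_path_def)
    next
      assume z: "z \<in> set P" and w: "w \<notin> set P"
      then obtain i where i: "i < ?p" "z = P ! i" by (metis in_set_conv_nth)
      have "pos w = 2 * side w + 1" using w by (simp add: pos_def)
      then have "side w = i" using zw pos_nth[OF i(1)] i(2) by simp
      then show ?thesis using side[OF zw(2) w] i adj_sym[OF wf] by blast
    next
      assume z: "z \<notin> set P" and w: "w \<in> set P"
      then obtain j where j: "j < ?p" "w = P ! j" by (metis in_set_conv_nth)
      have "pos z = 2 * side z + 1" using z by (simp add: pos_def)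
      then have "j = Suc (side z)" using zw pos_nth[OF j(1)] j(2) by simp
      then show ?thesis using side[OF zw(1) z] j by blast
    next
      assume z: "z \<notin> set P" and w: "w \<notin> set P"
      have "pos z = 2 * side z + 1" "pos w = 2 * side w + 1" using z w by (simp_all add: pos_def)
      \<comment> \<open>Spectators this close share the parade neighbour \<open>P ! side w\<close>,
        so crowdedness makes them adjacent.\<close>
      then have "side w = side z \<or> side w = Suc (side z)" using zw by auto
      then have "adj G z (P ! side w) \<and> adj G w (P ! side w)"
        using side[OF zw(1) z] side[OF zw(2) w] by auto
      moreover have "P ! side w \<in> set P" using side[OF zw(2) w] by simp
      ultimately show ?thesis using cr zw z w unfolding crowded_wrt_def by blast
    qed
    then show ?thesis using adj_sym[OF wf] by blast
  qed
  have "crowded_positions G ?p ((!) P) pos"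
  proof
    show "2 \<le> ?p" by (rule P(2))
    show "pos z \<le> 2 * (?p - 1)" if "z \<in> verts G" for z
    proof (cases "z \<in> set P")
      case True
      then obtain i where "i < ?p" "z = P ! i" by (metis in_set_conv_nth)
      then show ?thesis using pos_nth by simp
    next
      case False
      then have "pos z = 2 * side z + 1" by (simp add: pos_def)
      then show ?thesis using side[OF that False] by linarith
    qed
    show "P ! i \<in> verts G" "pos (P ! i) = 2 * i" if "i < ?p" for i using that PV pos_nth by auto
    show "P ! (pos z div 2) = z" if "z \<in> verts G" "even (pos z)" for z
    proof -
      have "z \<in> set P" using that(2) by (auto simp: pos_def split: if_splits)
      then obtain i where "i < ?p" "z = P ! i" by (metis in_set_conv_nth)
      then show ?thesis using pos_nth by simp
    qed
    show "adj G z w" if "z \<in> verts G" "w \<in> verts G" "z \<noteq> w" "pos z \<le> pos w + 2" "pos w \<le> pos z + 2" for z w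
      using near[of z w] near[of w z] that by (cases "pos z \<le> pos w") auto
  qed
  moreover have "\<forall>z\<in>set P. even (pos z)" by (simp add: pos_def)
  ultimately show ?thesis by blast
qed

section \<open>Minors with the same number of vertices\<close>

text \<open>Every step except an edge deletion loses a vertex.\<close>

lemma minor_steps_card:
  assumes "minor_step\<^sup>*\<^sup>* G H" "wf_graph G"
  shows "card (verts H) \<le> card (verts G) \<and> (card (verts H) = card (verts G) \<longrightarrow>
    verts H = verts G \<and> (\<forall>x y. mult H x y \<le> mult G x y))"
  using assms(1)
proof (induction rule: rtranclp_induct)
  case (step K L)
  have wf: "wf_graph K" using minor_steps_wf[OF step(1) assms(2)] .
  then have fin: "finite (verts K)" by (simp add: wf_graph_def)
  from step(2) have "card (verts L) < card (verts K) \<or>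
    verts L = verts K \<and> (\<forall>x y. mult L x y \<le> mult K x y)"
  proof cases
    case (del_vertex v)
    then have "v \<in> verts K" "verts L = verts K - {v}" by auto
    then have "card (verts L) < card (verts K)" using card_Diff1_less[OF fin] by (simp only:)
    then show ?thesis ..
  next
    case (contract u v)
    then have "v \<in> verts K" using adj_verts[OF wf, of u v] by (simp add: adj_def)
    moreover have "verts L = verts K - {v}" using contract(1) by simp
    ultimately have "card (verts L) < card (verts K)" using card_Diff1_less[OF fin] by (simp only:)
    then show ?thesis ..
  qed auto
  then show ?case
  proof
    assume "verts L = verts K \<and> (\<forall>x y. mult L x y \<le> mult K x y)"
    then show ?thesis using step.IH le_trans by metis
  qed (use step.IH in linarith)
qed simp

text \<open>Only edges were deleted, so relabelling \<open>H\<close> along the isomorphism turns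
  \<open>G\<close> into a literal subgraph on the same vertex set.\<close>

lemma minor_same_card:
  assumes "is_minor G H" and wf: "wf_graph G" "wf_graph H" and card: "card (verts H) = card (verts G)"
  shows "\<exists>K. wf_graph K \<and> verts K = verts G \<and> graph_iso H K \<and> (\<forall>x y. mult G x y \<le> mult K x y)"
proof -
  obtain H' where H': "minor_step\<^sup>*\<^sup>* H H'" "graph_iso H' G"
    using assms(1) unfolding is_minor_def by blast
  obtain f where f: "bij_betw f (verts H') (verts G)"
    and fm: "\<And>x y. x \<in> verts H' \<Longrightarrow> y \<in> verts H' \<Longrightarrow> mult G (f x) (f y) = mult H' x y"
    using H'(2) unfolding graph_iso_def by blast
  have "card (verts H') = card (verts H)" using bij_betw_same_card[OF f] card by simp
  then have V: "verts H' = verts H" and le: "\<And>x y. mult H' x y \<le> mult H x y"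
    using minor_steps_card[OF H'(1) wf(2)] by auto
  define g where "g = inv_into (verts H) f"
  have g: "g y \<in> verts H \<and> f (g y) = y" if "y \<in> verts G" for y
    using that f unfolding g_def V by (metis bij_betw_imp_surj_on f_inv_into_f inv_into_into)
  have gf: "g (f x) = x" and fV: "f x \<in> verts G" if "x \<in> verts H" for x
    using that f unfolding g_def V by (auto simp: bij_betw_inv_into_left bij_betw_apply)
  define K :: mgraph where
    "K = (verts G, \<lambda>x y. if x \<in> verts G \<and> y \<in> verts G then mult H (g x) (g y) else 0)"
  have VK: "verts K = verts G"
    and mK: "mult K x y = (if x \<in> verts G \<and> y \<in> verts G then mult H (g x) (g y) else 0)" for x y
    by (simp_all add: K_def)
  have "wf_graph K" using wf unfolding wf_graph_def VK mK by auto
  moreover have "graph_iso H K"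
    unfolding graph_iso_def using f gf fV by (intro exI[of _ f]) (simp add: V VK mK)
  moreover have "mult G x y \<le> mult K x y" for x y
  proof (cases "x \<in> verts G \<and> y \<in> verts G")
    case True
    then have "mult G x y = mult H' (g x) (g y)" using fm[of "g x" "g y"] g V by simp
    then show ?thesis using le True by (simp add: mK)
  next
    case False
    then show ?thesis using wf(1) unfolding wf_graph_def by (metis le0)
  qed
  ultimately show ?thesis using VK by blast
qed

section \<open>The spectator floor\<close>

lemma is_minor_refl: "is_minor G G"
proof -
  have "graph_iso G G" unfolding graph_iso_def by (intro exI[of _ id]) auto
  then show ?thesis unfolding is_minor_def by blast
qed

lemma sp_floor_attained:
  assumes "wf_graph G"
  shows "\<exists>H. wf_graph H \<and> is_minor G H \<and> sp_floor G = sp H"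
  unfolding sp_floor_def by (rule LeastI_ex) (use assms is_minor_refl in blast)

text \<open>The tool for lower bounds on \<open>sp H\<close>: a parade of \<open>H\<close> yields a
  layout with \<open>sp H\<close> vertices outside it, and passing to the minor does not increase
  that number.\<close>

lemma minor_layout:
  assumes "wf_graph G" "wf_graph H" "is_minor G H"
  shows "\<exists>Q l. layout G Q l \<and> card (verts G) \<le> sp H + card Q"
proof -
  obtain Q l where Q: "layout H Q l" "card Q + sp H = card (verts H)"
    using sp_layout[OF assms(2)] by blast
  obtain Q' l' where Q': "layout G Q' l'" "card (verts G) + card Q \<le> card (verts H) + card Q'"
    using layout_minor[OF assms(3,1,2) Q(1)] by blast
  then have "card (verts G) \<le> sp H + card Q'" using Q(2) by linarith
  then show ?thesis using Q'(1) by blast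
qed

text \<open>For \<open>p = 1\<close> any two vertices are joined by at least two edges, so a layout
  holds at most one vertex; otherwise this is \<open>layout_card\<close> with
  \<open>H = G\<close>.\<close>

lemma saturated_layout_card:
  assumes G: "saturated_crowded_parade m p G" and m: "p = 1 \<longrightarrow> 2 \<le> m"
    and lay: "layout G Q l"
  shows "card Q \<le> p"
proof (cases "p = 1")
  case True
  then have *: "\<And>x y. x \<in> verts G \<Longrightarrow> y \<in> verts G \<Longrightarrow> x \<noteq> y \<Longrightarrow> mult G x y = m"
    and wf: "wf_graph G" using G by (auto simp: saturated_crowded_parade_def)
  have fin: "finite Q" using lay wf unfolding layout_def wf_graph_def by (meson finite_subset)
  have "x = y" if "x \<in> Q" "y \<in> Q" for x y
  proof (rule ccontr)
    assume "x \<noteq> y"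
    moreover have "x \<in> verts G" "y \<in> verts G" using lay that by (auto simp: layout_def)
    ultimately have "mult G x y = m" using * by blast
    moreover have "mult G x y \<le> 1" using lay that by (simp add: layout_def)
    ultimately show False using m True by simp
  qed
  then show ?thesis using True fin by (simp add: card_le_Suc0_iff_eq)
next
  case False
  then obtain P where P: "wf_graph G" "is_usp G P" "length P = p" "2 \<le> p" "crowded_wrt G P"
    using G unfolding saturated_crowded_parade_def is_parade_def by auto
  then obtain pos where "crowded_positions G p ((!) P) pos"
    using crowded_positions_exist[of G P] by blast
  then show ?thesis using crowded_positions.layout_card lay P(1) by blast
qed

lemma saturated_usp:
  assumes G: "saturated_crowded_parade m p G" and m: "p = 1 \<longrightarrow> 2 \<le> m"
  shows "usp G = p"
proof (cases "p = 1")
  case True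
  have wf: "wf_graph G" using G by (simp add: saturated_crowded_parade_def)
  obtain Q where Q: "is_usp G Q" "length Q = usp G" using usp_attained[OF wf] by blast
  obtain l where l: "layout G (set Q) l" using usp_layout[OF wf Q(1)] by blast
  have "card (set Q) = usp G" using Q by (simp add: is_usp_def is_path_def distinct_card)
  moreover have "Q \<noteq> []" using Q by (simp add: is_usp_def is_path_def)
  ultimately show ?thesis using saturated_layout_card[OF G m l] True Q(2) by (cases Q) auto
qed (use G in \<open>auto simp: saturated_crowded_parade_def is_parade_def\<close>)

text \<open>\<open>G\<close> itself attains the value, and layouts of \<open>G\<close> are too small
  for any graph above it to do better.\<close>

lemma saturated_sp_floor:
  assumes G: "saturated_crowded_parade m p G" and m: "p = 1 \<longrightarrow> 2 \<le> m"
  shows "sp_floor G = card (verts G) - p"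
  unfolding sp_floor_def
proof (rule Least_equality)
  have wf: "wf_graph G" using G by (simp add: saturated_crowded_parade_def)
  show "\<exists>H. wf_graph H \<and> is_minor G H \<and> card (verts G) - p = sp H"
    using wf is_minor_refl saturated_usp[OF G m] by (intro exI[of _ G]) (simp add: sp_def)
  show "card (verts G) - p \<le> s" if s: "\<exists>H. wf_graph H \<and> is_minor G H \<and> s = sp H" for s
  proof -
    obtain H where H: "wf_graph H" "is_minor G H" "s = sp H" using s by blast
    obtain Q l where "layout G Q l" "card (verts G) \<le> sp H + card Q"
      using minor_layout[OF wf H(1,2)] by blast
    then show ?thesis using saturated_layout_card[OF G m, of Q l] H(3) by linarith
  qed
qed

lemma saturated_mult_le:
  assumes G: "saturated_crowded_parade m p G" and m: "1 \<le> m"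
  shows "mult G x y \<le> m"
proof (cases "adj G x y")
  case adj: True
  have wf: "wf_graph G" using G by (simp add: saturated_crowded_parade_def)
  show ?thesis
  proof (cases "p = 1")
    case True
    then show ?thesis using G adj_verts[OF wf adj] by (simp add: saturated_crowded_parade_def)
  next
    case False
    then obtain P where P: "is_usp G P" "\<And>x y. adj G x y \<Longrightarrow> \<not> parade_edge P x y \<Longrightarrow> mult G x y = m"
      using G unfolding saturated_crowded_parade_def is_parade_def by auto
    show ?thesis
    proof (cases "parade_edge P x y")
      case True
      then have "mult G x y = 1 \<or> mult G y x = 1" using P(1) unfolding parade_edge_def is_usp_def by blast
      then show ?thesis using wf m unfolding wf_graph_def by metis
    next
      case False
      then show ?thesis using P adj by simp
    qed
  qed
qed (simp add: adj_def)

section \<open>Maximality\<close>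

text \<open>For \<open>p \<ge> 2\<close>, \<open>rigid\<close> forbids new adjacencies, and edges
  off the parade already have multiplicity \<open>m\<close>. Parade edges stay single: for
  \<open>m \<ge> 2\<close> because edges at spectators are multiple, otherwise by the bound on
  \<open>K\<close>.\<close>

lemma saturated_rigid:
  assumes G: "saturated_crowded_parade m p G" and K: "wf_graph K" "verts K = verts G"
    and GK: "\<And>x y. mult G x y \<le> mult K x y" and Km: "\<And>x y. mult K x y \<le> m"
    and lay: "layout K Q l" "p \<le> card Q"
  shows "mult K x y = mult G x y"
proof (cases "adj K x y")
  case False
  then have "mult K x y = 0" by (simp add: adj_def)
  then show ?thesis using GK[of x y] by simp
next
  case adj: True
  have wf: "wf_graph G" using G by (simp add: saturated_crowded_parade_def)
  have xy: "x \<in> verts G" "y \<in> verts G" "x \<noteq> y" using adj_verts[OF K(1) adj] K(2) by auto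
  show ?thesis
  proof (cases "p = 1")
    case True
    then have "mult G x y = m" using G xy by (simp add: saturated_crowded_parade_def)
    then show ?thesis using GK[of x y] Km[of x y] by simp
  next
    case False
    then obtain P where P: "is_usp G P" "length P = p" "2 \<le> p" "crowded_wrt G P"
      and sat: "\<And>x y. adj G x y \<Longrightarrow> \<not> parade_edge P x y \<Longrightarrow> mult G x y = m"
      using G unfolding saturated_crowded_parade_def is_parade_def by auto
    obtain pos where pos: "crowded_positions G p ((!) P) pos" "\<forall>z\<in>set P. even (pos z)"
      using crowded_positions_exist[OF wf P(1)] P by auto
    note rigid = crowded_positions.rigid[OF pos(1) lay(1) K(1) wf K(2) GK lay(2)]
    have adjG: "adj G x y" using rigid(1) adj .
    show ?thesis
    proof (cases "parade_edge P x y")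
      case False
      then show ?thesis using sat[OF adjG] GK[of x y] Km[of x y] by simp
    next
      case True
      have "mult K x y \<le> 1"
      proof (cases "2 \<le> m")
        case m: True
        have "2 \<le> mult G z w" if "adj G z w" "odd (pos z)" for z w
        proof -
          have "z \<notin> set P" using pos(2) that(2) by blast
          then have "\<not> parade_edge P z w" unfolding parade_edge_def by auto
          then show ?thesis using sat[OF that(1)] m by simp
        qed
        then have "mult K (P ! i) (P ! Suc i) \<le> 1" if "Suc i < length P" for i
          using rigid(2) that P(2) by blast
        then show ?thesis using True K(1) unfolding parade_edge_def wf_graph_def by metis
      next
        case False
        then show ?thesis using Km[of x y] by simp
      qed
      then show ?thesis using adjG GK[of x y] by (simp add: adj_def)
    qed
  qed
qed

theorem theorem7p7:
  fixes n m k :: nat and G :: mgraph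
  assumes "(k + 2 \<le> n \<and> m \<ge> 1) \<or> (k + 1 = n \<and> m \<ge> 2)"
    and "saturated_crowded_parade m (n - k) G"
    and "card (verts G) = n"
  shows "minor_maximal (in_class n m k) G"
  unfolding minor_maximal_def
proof (intro conjI allI impI)
  have m: "n - k = 1 \<longrightarrow> 2 \<le> m" "1 \<le> m" and kn: "n - (n - k) = k" using assms(1) by auto
  have wf: "wf_graph G" using assms(2) by (simp add: saturated_crowded_parade_def)
  show "in_class n m k G"
    using saturated_sp_floor[OF assms(2) m(1)] saturated_mult_le[OF assms(2) m(2)] wf assms(3) kn
    by (simp add: in_class_def)
  fix H assume H: "in_class n m k H \<and> is_minor G H"
  then have wfH: "wf_graph H" and cH: "card (verts H) = n" and Hm: "\<And>x y. mult H x y \<le> m"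
    by (auto simp: in_class_def)
  obtain K where K: "wf_graph K" "verts K = verts G" "graph_iso H K" "\<And>x y. mult G x y \<le> mult K x y"
    using minor_same_card[OF _ wf wfH] H cH assms(3) by auto
  obtain f where f: "bij_betw f (verts H) (verts K)"
    "\<And>x y. x \<in> verts H \<Longrightarrow> y \<in> verts H \<Longrightarrow> mult K (f x) (f y) = mult H x y"
    using K(3) unfolding graph_iso_def by blast
  have Km: "mult K x y \<le> m" for x y
  proof (cases "x \<in> verts K \<and> y \<in> verts K")
    case True
    then obtain x' y' where "x = f x'" "x' \<in> verts H" "y = f y'" "y' \<in> verts H"
      using bij_betw_imp_surj_on[OF f(1)] by blast
    then show ?thesis using f(2) Hm by simp
  next
    case False
    then show ?thesis using K(1) unfolding wf_graph_def by (metis le0)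
  qed
  \<comment> \<open>A graph above \<open>H\<close> that attains the floor \<open>k\<close>; its
    parade gives \<open>H\<close>, and then the copy \<open>K\<close>, a layout with at least
    \<open>n - k\<close> vertices.\<close>
  obtain L where L: "wf_graph L" "is_minor H L" "sp L = k"
    using sp_floor_attained[OF wfH] H by (auto simp: in_class_def)
  obtain Q l where Q: "layout H Q l" "n \<le> k + card Q"
    using minor_layout[OF wfH L(1,2)] L(3) cH by auto
  obtain Q' l' where Q': "layout K Q' l'" "card Q' = card Q"
    using layout_iso[OF K(3,1) Q(1)] by blast
  have "n - k \<le> card Q'" using Q Q' by simp
  then have "mult K x y = mult G x y" for x y
    using saturated_rigid[OF assms(2) K(1,2,4) Km Q'(1)] by blast
  then show "graph_iso H G" using f K(2) unfolding graph_iso_def by auto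
qed

end
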